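(* Let $a\in L^\infty(0,1)$ satisfy $\int_0^1a(x)\,dx<0$ and suppose there is $z\in(0,1)$ such that $a(x)>0$ for a.e. $x\in(0,z)$ and $a(x)<0$ for a.e. $x\in(z,1)$. Suppose that $$\int_0^z\left(\int_x^za(t)\,dt\right)^{-\frac12}dx<\infty\quad\text{and}\quad\int_z^1\left(\int_x^za(t)\,dt\right)^{-\frac12}dx<\infty.$$ For a given function $f$ consider the problem $$-\left(\frac{u'}{\sqrt{1+(u')^2}}\right)'=\lambda a(x)f(u),\quad 0<x<1,\qquad u'(0)=u'(1)=0. \tag{P}$$ Then: (i) for every $p>1$ and $q\in(0,1)$ there exists a function $f$ satisfying condition $(f_1)$ (stated in the context) with these $p$ and $q$ for which (P) admits a singular solution $(\lambda_s,u_s)$ for some $\lambda_s>0$; (ii) for every $q\in(0,1)$ and $\overline\lambda>0$ there exist $\varepsilon>0$ and a function $f$ satisfying condition $(f_1)$ with $p=1$ and this $q$ such that (P) admits a singular solution $(\lambda_s,u_s)$ for some $\lambda_s>0$ with $|\lambda_s-\overline\lambda|<\varepsilon$.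
   Context: Condition $(f_1)$ with exponents $p>0$, $q\in(0,1)$: $f\in\mathcal C(\mathbb R)$, $f(0)=0$, $f(u)>0$ for $u>0$, and for some constant $h>0$, $\lim_{u\to0^+}\frac{f(u)}{u^p}=1$ and $\lim_{u\to\infty}\frac{f(u)}{u^{-q}}=h$. A function $u\in BV(0,1)$ is a bounded variation solution of (P) (for a given $\lambda$) if $$\int_0^1 \frac{Du^a\,D\phi^a}{\sqrt{1+(Du^a)^2}}\,dx+\int_0^1\frac{Du^s}{|Du^s|}\,D\phi^s=\int_0^1\lambda a f(u)\phi\,dx$$ for every $\phi\in BV(0,1)$ such that $|D\phi^s|$ is absolutely continuous with respect to $|Du^s|$. Here, for $v\in BV(0,1)$, $Dv=Dv^a\,dx+Dv^s$ is the Lebesgue decomposition of the measure $Dv$, and $\frac{Dv^s}{|Dv^s|}$ is the density of $Dv^s$ with respect to its total variation $|Dv^s|$. A regular solution is a function $u\in W^{2,1}(0,1)$ satisfying the equation a.e. and the boundary conditions; a bounded variation solution which is not regular is called singular. All solutions are understood to be positive: $\operatorname{ess\,inf}u\ge0$ and $\operatorname{ess\,sup}u>0$. A pair $(\lambda,u)$ is a solution if $u$ is a solution for that value of $\lambda$. *)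

theory Defs
  imports "HOL-Analysis.Analysis" "HOL-Probability.Essential_Supremum"
begin

text \<open>Functions on \<open>(0,1)\<close> are total functions on the reals of which only the values on
  \<open>(0,1)\<close>, up to Lebesgue null sets, matter.\<close>

abbreviation leb01 :: "real measure" where
  "leb01 \<equiv> lebesgue_on {0<..<1}"

abbreviation borel01 :: "real measure" where
  "borel01 \<equiv> restrict_space borel {0<..<1}"

definition Linf01 :: "(real \<Rightarrow> real) set" where
  "Linf01 = {a. a \<in> borel_measurable leb01 \<and> esssup leb01 (\<lambda>x. ereal \<bar>a x\<bar>) < \<infinity>}"


section \<open>Finite signed Borel measures on (0,1)\<close>

text \<open>A finite signed measure \<open>\<nu>\<close> is encoded by its (unique) Jordan decomposition: the pair
  \<open>(P, N)\<close> of mutually singular finite positive measures with \<open>\<nu> = P - N\<close>.\<close>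

type_synonym smeasure = "real measure \<times> real measure"

definition signed_measure01 :: "smeasure \<Rightarrow> bool" where
  "signed_measure01 \<nu> \<longleftrightarrow>
     finite_measure (fst \<nu>) \<and> sets (fst \<nu>) = sets borel01 \<and>
     finite_measure (snd \<nu>) \<and> sets (snd \<nu>) = sets borel01 \<and>
     (\<exists>A\<in>sets borel01. emeasure (snd \<nu>) A = 0 \<and> emeasure (fst \<nu>) ({0<..<1} - A) = 0)"

definition sm_val :: "smeasure \<Rightarrow> real set \<Rightarrow> real" where
  "sm_val \<nu> B = measure (fst \<nu>) B - measure (snd \<nu>) B"

definition sm_integral :: "smeasure \<Rightarrow> (real \<Rightarrow> real) \<Rightarrow> real" where
  "sm_integral \<nu> h = (LINT x|fst \<nu>. h x) - (LINT x|snd \<nu>. h x)"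

text \<open>The total variation measure \<open>|\<nu>| = P + N\<close>.\<close>

definition variation :: "smeasure \<Rightarrow> real measure" where
  "variation \<nu> =
     measure_of {0<..<1} (sets borel01) (\<lambda>B. emeasure (fst \<nu>) B + emeasure (snd \<nu>) B)"

lemma sets_variation [simp]: "sets (variation \<nu>) = sets borel01"
proof -
  have "sigma_sets {0<..<1} (sets borel01) = sets borel01"
    using sets.sigma_sets_eq[of borel01] by (simp add: space_restrict_space)
  moreover have "sets borel01 \<subseteq> Pow {0<..<1}"
    using sets.space_closed[of borel01] by (simp add: space_restrict_space)
  ultimately show ?thesis
    unfolding variation_def by simp
qed

lemma emeasure_variation:
  assumes "signed_measure01 \<nu>" and B: "B \<in> sets borel01"
  shows "emeasure (variation \<nu>) B = emeasure (fst \<nu>) B + emeasure (snd \<nu>) B"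
proof (rule emeasure_measure_of[OF variation_def])
  have s: "sets (fst \<nu>) = sets borel01" "sets (snd \<nu>) = sets borel01"
    using assms(1) by (auto simp: signed_measure01_def)
  show "sets borel01 \<subseteq> Pow {0<..<1}"
    using sets.space_closed[of borel01] by (simp add: space_restrict_space)
  show "B \<in> sets (variation \<nu>)" using B by simp
  show "positive (sets (variation \<nu>)) (\<lambda>B. emeasure (fst \<nu>) B + emeasure (snd \<nu>) B)"
    by (simp add: positive_def)
  show "countably_additive (sets (variation \<nu>)) (\<lambda>B. emeasure (fst \<nu>) B + emeasure (snd \<nu>) B)"
  proof (rule countably_additiveI)
    fix A :: "nat \<Rightarrow> real set"
    assume A: "range A \<subseteq> sets (variation \<nu>)" "disjoint_family A"
    show "(\<Sum>i. emeasure (fst \<nu>) (A i) + emeasure (snd \<nu>) (A i)) =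
          emeasure (fst \<nu>) (\<Union>i. A i) + emeasure (snd \<nu>) (\<Union>i. A i)"
      using A s by (simp add: suminf_add[symmetric] suminf_emeasure)
  qed
qed

definition sm_density :: "smeasure \<Rightarrow> real measure \<Rightarrow> (real \<Rightarrow> real) \<Rightarrow> bool" where
  "sm_density \<nu> M h \<longleftrightarrow>
     integrable M h \<and> (\<forall>B\<in>sets borel01. sm_val \<nu> B = (LINT x:B|M. h x))"

text \<open>\<open>\<nu> = g dx + \<sigma>\<close> with \<open>\<sigma>\<close> concentrated on a Lebesgue null set; \<open>g\<close> is unique a.e. and
  \<open>\<sigma>\<close> is unique.\<close>

definition lebesgue_decomposition :: "smeasure \<Rightarrow> (real \<Rightarrow> real) \<Rightarrow> smeasure \<Rightarrow> bool" where
  "lebesgue_decomposition \<nu> g \<sigma> \<longleftrightarrow>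
     integrable leb01 g \<and> signed_measure01 \<sigma> \<and>
     (\<exists>A\<in>sets borel01. emeasure lborel A = 0 \<and> emeasure (variation \<sigma>) ({0<..<1} - A) = 0) \<and>
     (\<forall>B\<in>sets borel01. sm_val \<nu> B = (LINT x:B|leb01. g x) + sm_val \<sigma> B)"


section \<open>Functions of bounded variation and Sobolev functions\<close>

definition test_fun :: "(real \<Rightarrow> real) \<Rightarrow> bool" where
  "test_fun \<psi> \<longleftrightarrow> \<psi> C1_differentiable_on UNIV \<and>
     compact (closure {x. \<psi> x \<noteq> 0}) \<and> closure {x. \<psi> x \<noteq> 0} \<subseteq> {0<..<1}"

definition derivative_measure :: "(real \<Rightarrow> real) \<Rightarrow> smeasure \<Rightarrow> bool" where
  "derivative_measure u \<nu> \<longleftrightarrow> signed_measure01 \<nu> \<and>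
     (\<forall>\<psi>. test_fun \<psi> \<longrightarrow> (LINT x|leb01. u x * deriv \<psi> x) = - sm_integral \<nu> \<psi>)"

definition BV01 :: "(real \<Rightarrow> real) set" where
  "BV01 = {u. integrable leb01 u \<and> (\<exists>\<nu>. derivative_measure u \<nu>)}"

definition derivative_parts :: "(real \<Rightarrow> real) \<Rightarrow> (real \<Rightarrow> real) \<Rightarrow> smeasure \<Rightarrow> bool" where
  "derivative_parts u ua us \<longleftrightarrow>
     (\<exists>\<nu>. derivative_measure u \<nu> \<and> lebesgue_decomposition \<nu> ua us)"

definition weak_deriv :: "(real \<Rightarrow> real) \<Rightarrow> (real \<Rightarrow> real) \<Rightarrow> bool" where
  "weak_deriv u v \<longleftrightarrow> integrable leb01 u \<and> integrable leb01 v \<and>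
     (\<forall>\<psi>. test_fun \<psi> \<longrightarrow> (LINT x|leb01. u x * deriv \<psi> x) = - (LINT x|leb01. v x * \<psi> x))"


section \<open>Solutions of the problem\<close>

definition cond_f1 :: "real \<Rightarrow> real \<Rightarrow> (real \<Rightarrow> real) \<Rightarrow> bool" where
  "cond_f1 p q f \<longleftrightarrow> continuous_on UNIV f \<and> f 0 = 0 \<and> (\<forall>u>0. f u > 0) \<and>
     ((\<lambda>u. f u / u powr p) \<longlongrightarrow> 1) (at_right 0) \<and>
     (\<exists>h>0. ((\<lambda>u. f u / u powr (- q)) \<longlongrightarrow> h) at_top)"

text \<open>Below, \<open>ua\<close> and \<open>us\<close> are \<open>Du\<^sup>a\<close> and \<open>Du\<^sup>s\<close>, \<open>\<theta>\<close> is \<open>Du\<^sup>s / |Du\<^sup>s|\<close>, and similarly for \<open>\<phi>\<close>.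
  These are unique up to null sets, and every function in \<open>BV01\<close> has such parts, so the choice
  of quantifiers over them is immaterial.\<close>

definition bv_solution :: "(real \<Rightarrow> real) \<Rightarrow> (real \<Rightarrow> real) \<Rightarrow> real \<Rightarrow> (real \<Rightarrow> real) \<Rightarrow> bool" where
  "bv_solution a f lam u \<longleftrightarrow> u \<in> BV01 \<and>
     (\<exists>ua us \<theta>. derivative_parts u ua us \<and> sm_density us (variation us) \<theta> \<and>
       (\<forall>\<phi>\<in>BV01. \<forall>\<phi>a \<phi>s. derivative_parts \<phi> \<phi>a \<phi>s \<and>
          absolutely_continuous (variation us) (variation \<phi>s) \<longrightarrow>
          (LINT x|leb01. ua x * \<phi>a x / sqrt (1 + (ua x)\<^sup>2)) + sm_integral \<phi>s \<theta>
            = (LINT x|leb01. lam * a x * f (u x) * \<phi> x)))"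

definition positive_fun :: "(real \<Rightarrow> real) \<Rightarrow> bool" where
  "positive_fun u \<longleftrightarrow>
     - esssup leb01 (\<lambda>x. - ereal (u x)) \<ge> 0 \<and> esssup leb01 (\<lambda>x. ereal (u x)) > 0"

text \<open>For \<open>u\<close> in \<open>W\<^sup>2\<^sup>,\<^sup>1(0,1)\<close>, \<open>v\<close> is the representative of \<open>u'\<close> that is continuous on \<open>[0,1]\<close>;
  it is absolutely continuous, and the boundary conditions refer to it.\<close>

definition regular_solution :: "(real \<Rightarrow> real) \<Rightarrow> (real \<Rightarrow> real) \<Rightarrow> real \<Rightarrow> (real \<Rightarrow> real) \<Rightarrow> bool" where
  "regular_solution a f lam u \<longleftrightarrow>
     (\<exists>v w. weak_deriv u v \<and> weak_deriv v w \<and> continuous_on {0..1} v \<and>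
        v 0 = 0 \<and> v 1 = 0 \<and>
        (AE x in leb01. ((\<lambda>t. - (v t / sqrt (1 + (v t)\<^sup>2))) has_real_derivative
                           lam * a x * f (u x)) (at x)))"

definition singular_solution :: "(real \<Rightarrow> real) \<Rightarrow> (real \<Rightarrow> real) \<Rightarrow> real \<Rightarrow> (real \<Rightarrow> real) \<Rightarrow> bool" where
  "singular_solution a f lam u \<longleftrightarrow>
     bv_solution a f lam u \<and> positive_fun u \<and> \<not> regular_solution a f lam u"

end

theory Submission
  imports Defs "HOL-Probability.Giry_Monad"
begin

text \<open>
The freedom in the nonlinearity makes the problem explicitly solvable. In terms of the flux
\<open>w = -u' / sqrt(1 + u'\<^sup>2)\<close> the equation is \<open>w' = \<lambda> a f(u)\<close> with \<open>w(0) = w(1) = 0\<close>, and a solution may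
jump downwards exactly where \<open>w\<close> reaches the value \<open>1\<close>. As \<open>a\<close> is positive on \<open>(0,z)\<close> and negative on
\<open>(z,1)\<close>, the flux has its maximum at \<open>z\<close>, so the jump has to be placed there.

Suppose that the values of \<open>u\<close> on \<open>(0,z)\<close> lie in an interval on which \<open>f\<close> is a constant \<open>c1\<close>, and those
on \<open>(z,1)\<close> in a lower, disjoint interval on which \<open>f\<close> is a constant \<open>c2\<close>. Then the equation is linear
in \<open>w\<close>, and \<open>w\<close> rises from \<open>0\<close> to \<open>1\<close> and falls back to \<open>0\<close> precisely when
\<open>\<lambda> c1 \<integral>\<^sub>0\<^sup>z a = 1\<close> and \<open>\<lambda> c2 \<integral>\<^sub>z\<^sup>1 a = -1\<close>. The slope \<open>u' = -w / sqrt(1 - w\<^sup>2)\<close> is of the order of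
\<open>-(1 - w)\<^sup>-\<^sup>1\<^sup>/\<^sup>2\<close>, that is, of \<open>-(\<integral>\<^sub>x\<^sup>z a)\<^sup>-\<^sup>1\<^sup>/\<^sup>2\<close>, so by the two integrability hypotheses \<open>u\<close> stays
bounded on both sides of \<open>z\<close> (\<open>integrable_slope_if_rsqrt\<close>). A jump of height \<open>1\<close> at \<open>z\<close> separates the two
ranges, and adding a large constant to \<open>u\<close> moves them away from \<open>0\<close>, so that a nonlinearity with these
two plateaus and the prescribed behaviour at \<open>0\<close> and at infinity exists (\<open>ex_nonlinearity\<close>). The value of
\<open>\<lambda>\<close> is arbitrary, since \<open>c1\<close> and \<open>c2\<close> absorb it; in the second part \<open>\<lambda>\<close> is the prescribed value itself.

That this \<open>u\<close> is a bounded variation solution amounts to the integration by parts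
\<open>\<integral> w' \<phi> = -\<integral> w dD\<phi>\<close> for \<open>\<phi>\<close> of bounded variation and the Lipschitz function \<open>w\<close>
(\<open>BV_integration_by_parts\<close>), followed by the splitting of \<open>D\<phi>\<close> into its absolutely continuous and
singular parts; the latter is an atom at \<open>z\<close>, where \<open>w = 1\<close> (\<open>jump_function_bv_solution\<close>). It is not
regular, because a function with a jump has no integrable weak derivative
(\<open>jump_function_not_weakly_differentiable\<close>).
\<close>

section \<open>Charges acting on bounded Borel functions\<close>

lemma space_borel01 [simp]: "space borel01 = {0<..<1}"
  by (simp add: space_restrict_space)

lemma sets_borel01_iff: "B \<in> sets borel01 \<longleftrightarrow> B \<in> sets borel \<and> B \<subseteq> {0<..<1}"
  by (subst sets_restrict_space_iff) auto

lemma borel01_subset_leb01: "sets borel01 \<subseteq> sets leb01"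
  unfolding sets_restrict_space by (intro image_mono) auto

lemma borel01_measurable_mono:
  assumes "h \<in> borel_measurable borel01" "space M = {0<..<1}" "sets borel01 \<subseteq> sets M"
  shows "h \<in> borel_measurable M"
  using measurable_sets[OF assms(1)] assms(2,3) by (intro measurableI) auto

lemma integrable_bounded_mult:
  fixes h \<phi> :: "real \<Rightarrow> real"
  assumes \<phi>: "integrable M \<phi>" and h: "h \<in> borel_measurable M"
    and K: "\<And>x. x \<in> space M \<Longrightarrow> \<bar>h x\<bar> \<le> K"
  shows "integrable M (\<lambda>x. h x * \<phi> x)"
proof (rule Bochner_Integration.integrable_bound)
  show "integrable M (\<lambda>x. K * \<phi> x)" using \<phi> by simp
  show "(\<lambda>x. h x * \<phi> x) \<in> borel_measurable M" using \<phi> h by measurable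
  show "AE x in M. norm (h x * \<phi> x) \<le> norm (K * \<phi> x)"
  proof (rule AE_I2)
    fix x assume "x \<in> space M"
    then have "\<bar>h x\<bar> \<le> \<bar>K\<bar>" using K by fastforce
    then show "norm (h x * \<phi> x) \<le> norm (K * \<phi> x)"
      by (simp add: abs_mult mult_right_mono)
  qed
qed

lemma tendsto_sum_list:
  fixes F :: "'a \<Rightarrow> nat \<Rightarrow> real"
  assumes "\<And>m. m \<in> set ms \<Longrightarrow> F m \<longlonglongrightarrow> G m"
  shows "(\<lambda>i. \<Sum>m\<leftarrow>ms. F m i) \<longlonglongrightarrow> (\<Sum>m\<leftarrow>ms. G m)"
  using assms
proof (induction ms)
  case (Cons a ms)
  then show ?case by (auto intro: tendsto_add)
qed simp

text \<open>An identity between charges that is known on Borel sets passes to bounded Borel integrands, by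
  the usual ladder: indicators, nonnegative combinations, monotone limits. Attaching an integrable
  weight to each measure handles positive measures (weights \<open>1\<close> and \<open>-1\<close>) and signed densities
  with respect to Lebesgue measure (weight the density) at the same time.\<close>

lemma weighted_integrals_cancel:
  fixes ms :: "(real measure \<times> (real \<Rightarrow> real)) list"
  assumes ms: "\<And>m. m \<in> set ms \<Longrightarrow>
      integrable (fst m) (snd m) \<and> space (fst m) = {0<..<1} \<and> sets borel01 \<subseteq> sets (fst m)"
    and zero: "\<And>B. B \<in> sets borel01 \<Longrightarrow> (\<Sum>m\<leftarrow>ms. LINT x:B|fst m. snd m x) = 0"
    and h: "h \<in> borel_measurable borel01" and K: "\<And>x. x \<in> {0<..<1} \<Longrightarrow> \<bar>h x\<bar> \<le> K"
  shows "(\<Sum>m\<leftarrow>ms. LINT x|fst m. h x * snd m x) = 0"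
proof -
  define L where "L h = (\<Sum>m\<leftarrow>ms. LINT x|fst m. h x * snd m x)" for h
  have int: "integrable (fst m) (\<lambda>x. h x * snd m x)"
    if "m \<in> set ms" "h \<in> borel_measurable borel01" "\<And>x. x \<in> {0<..<1} \<Longrightarrow> \<bar>h x\<bar> \<le> K"
    for m h K
  proof (rule integrable_bounded_mult)
    show "integrable (fst m) (snd m)" using ms[OF that(1)] by blast
    show "h \<in> borel_measurable (fst m)"
      using ms[OF that(1)] that(2) by (blast intro: borel01_measurable_mono)
    show "\<bar>h x\<bar> \<le> K" if "x \<in> space (fst m)" for x
      using ms[OF \<open>m \<in> set ms\<close>] that \<open>\<And>x. x \<in> {0<..<1} \<Longrightarrow> \<bar>h x\<bar> \<le> K\<close> by metis
  qed
  have L_add: "L (\<lambda>x. g x + h x) = L g + L h"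
    if "g \<in> borel_measurable borel01" "\<And>x. x \<in> {0<..<1} \<Longrightarrow> \<bar>g x\<bar> \<le> K"
      "h \<in> borel_measurable borel01" "\<And>x. x \<in> {0<..<1} \<Longrightarrow> \<bar>h x\<bar> \<le> K'" for g h K K'
  proof -
    have "L (\<lambda>x. g x + h x) = (\<Sum>m\<leftarrow>ms. (LINT x|fst m. g x * snd m x) + (LINT x|fst m. h x * snd m x))"
      unfolding L_def
    proof (intro arg_cong[where f=sum_list] map_cong refl)
      fix m assume "m \<in> set ms"
      then show "(LINT x|fst m. (g x + h x) * snd m x)
          = (LINT x|fst m. g x * snd m x) + (LINT x|fst m. h x * snd m x)"
        using int[of m g K, OF _ that(1,2)] int[of m h K', OF _ that(3,4)] by (simp add: distrib_right)
    qed
    then show ?thesis by (simp add: L_def sum_list_addf)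
  qed
  have scale: "L (\<lambda>x. c * h x) = c * L h" for c h
    by (simp add: L_def mult.assoc flip: sum_list_const_mult)
  have ind: "L (indicator A) = 0" if "A \<in> sets borel01" for A
    using zero[OF that] by (simp add: L_def set_lebesgue_integral_def)
  have nonneg: "(\<forall>x\<in>{0<..<1}. h x \<le> K) \<longrightarrow> L h = 0"
    if hm: "h \<in> borel_measurable borel01" and h0: "\<And>x. 0 \<le> h x" for h K
    using hm h0
  proof (induction arbitrary: K rule: borel_measurable_induct_real)
    case (set A)
    then show ?case using ind by auto
  next
    case (mult u c)
    show ?case
    proof (cases "c = 0")
      case True then show ?thesis using scale[of 0 u] by simp
    next
      case False
      then have "c > 0" using mult by simp
      then show ?thesis using mult.IH[of "K / c"] by (auto simp: scale field_simps)
    qed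
  next
    case (add u v)
    show ?case
    proof
      assume b: "\<forall>x\<in>{0<..<1}. v x + u x \<le> K"
      have le: "u x \<le> K \<and> v x \<le> K" if "x \<in> {0<..<1}" for x
        using bspec[OF b that] add.hyps(2)[of x] add.hyps(4)[of x] by linarith
      have "L (\<lambda>x. v x + u x) = L v + L u"
        by (rule L_add[of v K u K]) (use le add.hyps in auto)
      then show "L (\<lambda>x. v x + u x) = 0"
        using add.IH(1)[of K] add.IH(2)[of K] le by auto
    qed
  next
    case (seq U)
    have hm': "h \<in> borel_measurable borel01"
      by (rule borel_measurable_LIMSEQ_real[OF seq.hyps(4) seq.hyps(1)])
    show ?case
    proof
      assume b: "\<forall>x\<in>{0<..<1}. h x \<le> K"
      have Ub: "0 \<le> U i x" "U i x \<le> K" if "x \<in> {0<..<1}" for i x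
      proof -
        have "incseq (\<lambda>i. U i x)" using seq.hyps(3) by (auto simp: incseq_def le_fun_def)
        then have "U i x \<le> h x" using seq.hyps(4)[of x] that by (intro incseq_le) auto
        then show "U i x \<le> K" using bspec[OF b that] by linarith
        show "0 \<le> U i x" using seq.hyps(2) .
      qed
      have "(\<lambda>i. L (U i)) \<longlonglongrightarrow> L h"
        unfolding L_def
      proof (rule tendsto_sum_list)
        fix m assume m: "m \<in> set ms"
        show "(\<lambda>i. LINT x|fst m. U i x * snd m x) \<longlonglongrightarrow> (LINT x|fst m. h x * snd m x)"
        proof (rule integral_dominated_convergence[where w="\<lambda>x. K * \<bar>snd m x\<bar>"])
          show "(\<lambda>x. h x * snd m x) \<in> borel_measurable (fst m)"
            "\<And>i. (\<lambda>x. U i x * snd m x) \<in> borel_measurable (fst m)"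
            using ms[OF m] borel01_measurable_mono[of _ "fst m"] seq.hyps(1) hm'
            by (blast intro: borel_measurable_times borel_measurable_integrable)+
          show "integrable (fst m) (\<lambda>x. K * \<bar>snd m x\<bar>)" using ms[OF m] by simp
          show "AE x in fst m. (\<lambda>i. U i x * snd m x) \<longlonglongrightarrow> h x * snd m x"
            using seq.hyps(4) ms[OF m] by (intro AE_I2 tendsto_mult_right) auto
          show "AE x in fst m. norm (U i x * snd m x) \<le> K * \<bar>snd m x\<bar>" for i
            using Ub ms[OF m] by (intro AE_I2) (auto simp: abs_mult intro!: mult_right_mono)
        qed
      qed
      moreover have "L (U i) = 0" for i using seq.IH[of i K] Ub by auto
      ultimately show "L h = 0" by (simp add: LIMSEQ_unique)
    qed
  qed
  \<comment> \<open>Adding the bound makes \<open>h\<close> nonnegative; its values off \<open>(0,1)\<close> are irrelevant but must not spoil this.\<close>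
  define h' where "h' x = (if x \<in> {0<..<1} then h x else K)" for x
  have h'm: "h' \<in> borel_measurable borel01"
    using h by (subst measurable_cong[where g=h]) (auto simp: h'_def)
  have "0 \<le> h' x + \<bar>K\<bar>" for x using K[of x] by (auto simp: h'_def)
  moreover have "h' x + \<bar>K\<bar> \<le> 2 * \<bar>K\<bar>" for x using K[of x] by (auto simp: h'_def)
  ultimately have "L (\<lambda>x. h' x + \<bar>K\<bar>) = 0"
    using nonneg[of "\<lambda>x. h' x + \<bar>K\<bar>" "2 * \<bar>K\<bar>"] h'm by auto
  moreover have "L (\<lambda>x. \<bar>K\<bar>) = 0" using nonneg[of "\<lambda>x. \<bar>K\<bar>" "\<bar>K\<bar>"] by auto
  moreover have "L (\<lambda>x. h' x + \<bar>K\<bar>) = L h' + L (\<lambda>x. \<bar>K\<bar>)"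
    using K h'm by (intro L_add[of h' "\<bar>K\<bar>" _ "\<bar>K\<bar>"]) (fastforce simp: h'_def)+
  moreover have "L h' = L h"
    unfolding L_def h'_def
    by (intro arg_cong[where f=sum_list] map_cong refl Bochner_Integration.integral_cong) (use ms in auto)
  ultimately show ?thesis by (simp add: L_def)
qed

lemma signed_measure01D:
  assumes "signed_measure01 \<nu>"
  shows "finite_measure (fst \<nu>)" "finite_measure (snd \<nu>)"
    "sets (fst \<nu>) = sets borel01" "sets (snd \<nu>) = sets borel01"
    "space (fst \<nu>) = {0<..<1}" "space (snd \<nu>) = {0<..<1}"
proof -
  show s: "sets (fst \<nu>) = sets borel01" "sets (snd \<nu>) = sets borel01"
    "finite_measure (fst \<nu>)" "finite_measure (snd \<nu>)"
    using assms by (auto simp: signed_measure01_def)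
  show "space (fst \<nu>) = {0<..<1}" "space (snd \<nu>) = {0<..<1}"
    using sets_eq_imp_space_eq[OF s(1)] sets_eq_imp_space_eq[OF s(2)] by simp_all
qed

lemma space_variation [simp]: "space (variation \<nu>) = {0<..<1}"
  using sets_eq_imp_space_eq[OF sets_variation[of \<nu>]] by simp

lemma set_integral_const_measure:
  fixes c :: real
  assumes "finite_measure M" "B \<in> sets M"
  shows "(LINT x:B|M. c) = c * measure M B"
proof -
  interpret finite_measure M by fact
  show ?thesis using assms(2) by (simp add: set_lebesgue_integral_def mult.commute)
qed

lemma finite_measure_variation:
  assumes "signed_measure01 \<sigma>"
  shows "finite_measure (variation \<sigma>)"
proof (rule finite_measureI)
  interpret P: finite_measure "fst \<sigma>" by (rule signed_measure01D[OF assms])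
  interpret N: finite_measure "snd \<sigma>" by (rule signed_measure01D[OF assms])
  have "{0<..<1} \<in> sets borel01" by (simp add: sets_borel01_iff)
  then show "emeasure (variation \<sigma>) (space (variation \<sigma>)) \<noteq> \<infinity>"
    using emeasure_variation[OF assms] by (simp add: P.emeasure_eq_measure N.emeasure_eq_measure
      flip: ennreal_plus)
qed

lemma measure_variation:
  assumes "signed_measure01 \<sigma>" "B \<in> sets borel01"
  shows "measure (variation \<sigma>) B = measure (fst \<sigma>) B + measure (snd \<sigma>) B"
proof -
  interpret P: finite_measure "fst \<sigma>" by (rule signed_measure01D[OF assms(1)])
  interpret N: finite_measure "snd \<sigma>" by (rule signed_measure01D[OF assms(1)])
  show ?thesis
    using emeasure_variation[OF assms] unfolding measure_def
    by (simp add: P.emeasure_eq_measure N.emeasure_eq_measure enn2real_plus)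
qed

lemma integral_variation:
  fixes h :: "real \<Rightarrow> real"
  assumes \<sigma>: "signed_measure01 \<sigma>" and h: "h \<in> borel_measurable borel01"
    and K: "\<And>x. x \<in> {0<..<1} \<Longrightarrow> \<bar>h x\<bar> \<le> K"
  shows "(LINT x|variation \<sigma>. h x) = (LINT x|fst \<sigma>. h x) + (LINT x|snd \<sigma>. h x)"
proof -
  note D = signed_measure01D[OF \<sigma>]
  interpret P: finite_measure "fst \<sigma>" by (rule D)
  interpret N: finite_measure "snd \<sigma>" by (rule D)
  interpret V: finite_measure "variation \<sigma>" by (rule finite_measure_variation[OF \<sigma>])
  let ?ms = "[(variation \<sigma>, \<lambda>x. 1), (fst \<sigma>, \<lambda>x. -1), (snd \<sigma>, \<lambda>x. -1 :: real)]"
  have "(\<Sum>m\<leftarrow>?ms.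
      LINT x|fst m. h x * snd m x) = 0"
  proof (rule weighted_integrals_cancel[OF _ _ h K])
    fix B assume B: "B \<in> sets borel01"
    then show "(\<Sum>m\<leftarrow>?ms.
      LINT x:B|fst m. snd m x) = 0"
      using set_integral_const_measure[of "variation \<sigma>" B 1] set_integral_const_measure[of "fst \<sigma>" B "-1"]
        set_integral_const_measure[of "snd \<sigma>" B "-1"] D V.finite_measure_axioms measure_variation[OF \<sigma> B]
      by simp
  qed (use D in \<open>auto\<close>)
  then show ?thesis by simp
qed

text \<open>The defining property of the Lebesgue decomposition is about sets; the weak formulation of the
  problem integrates functions.\<close>

lemma sm_integral_decomposition:
  assumes \<nu>: "signed_measure01 \<nu>" and dec: "lebesgue_decomposition \<nu> g \<sigma>"
    and h: "h \<in> borel_measurable borel01"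
    and K: "\<And>x. x \<in> {0<..<1} \<Longrightarrow> \<bar>h x\<bar> \<le> K"
  shows "sm_integral \<nu> h = (LINT x|leb01. h x * g x) + sm_integral \<sigma> h"
proof -
  have \<sigma>: "signed_measure01 \<sigma>" and g: "integrable leb01 g"
    and val: "\<And>B. B \<in> sets borel01 \<Longrightarrow> sm_val \<nu> B = (LINT x:B|leb01. g x) + sm_val \<sigma> B"
    using dec by (auto simp: lebesgue_decomposition_def)
  note D = signed_measure01D[OF \<nu>] signed_measure01D[OF \<sigma>]
  interpret P: finite_measure "fst \<nu>" by (rule D)
  interpret N: finite_measure "snd \<nu>" by (rule D)
  interpret P': finite_measure "fst \<sigma>" by (rule D)
  interpret N': finite_measure "snd \<sigma>" by (rule D)
  let ?ms = "[(fst \<nu>, \<lambda>x. 1), (snd \<nu>, \<lambda>x. -1), (leb01, \<lambda>x. - g x),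
    (fst \<sigma>, \<lambda>x. -1), (snd \<sigma>, \<lambda>x. 1)]"
  have "(\<Sum>m\<leftarrow>?ms. LINT x|fst m. h x * snd m x) = 0"
  proof (rule weighted_integrals_cancel[OF _ _ h K])
    fix B assume B: "B \<in> sets borel01"
    have "(LINT x:B|leb01. - g x) = - (LINT x:B|leb01. g x)"
      by (simp add: set_lebesgue_integral_def)
    then show "(\<Sum>m\<leftarrow>?ms. LINT x:B|fst m. snd m x) = 0"
      using set_integral_const_measure[of "fst \<nu>" B 1] set_integral_const_measure[of "snd \<nu>" B "-1"]
        set_integral_const_measure[of "fst \<sigma>" B "-1"] set_integral_const_measure[of "snd \<sigma>" B 1]
        D val[OF B] B by (simp add: sm_val_def)
  qed (use D g borel01_subset_leb01 in \<open>auto\<close>)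
  then show ?thesis by (simp add: sm_integral_def)
qed

section \<open>Nonlinearities with prescribed plateaus\<close>

text \<open>Near \<open>0\<close> and near infinity the conditions on the nonlinearity are rigid, but between the two it can
  be anything positive: it is the minimum of \<open>u\<^sup>p\<close> and a profile \<open>s\<close> that equals \<open>c2\<close> up to \<open>B\<close>, moves
  linearly to \<open>c1\<close> on \<open>[B, B+1]\<close>, stays there up to \<open>D\<close> and then decays like \<open>u\<^sup>-\<^sup>q\<close>. The lower bounds
  on \<open>A\<close> ensure that the minimum is \<open>s\<close> from \<open>A\<close> on.\<close>

lemma ex_nonlinearity:
  fixes p q c1 c2 A B D :: real
  assumes p1: "p \<ge> 1" and q: "q > 0" and c: "c1 > 0" "c2 > 0" and A: "A \<ge> 1" "A \<ge> c1" "A \<ge> c2" and B: "A \<le> B" "B + 1 \<le> D"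
  shows "\<exists>f. cond_f1 p q f \<and> (\<forall>u\<in>{A..B}. f u = c2) \<and> (\<forall>u\<in>{B+1..D}. f u = c1)"
proof -
  define s where "s u = (c2 + (c1 - c2) * max 0 (min 1 (u - B))) * (max D u / D) powr (-q)" for u
  define f where "f u = min (max u 0 powr p) (s u)" for u
  have pq: "p > 0" using p1 by simp
  have D: "D > 0" using A B by linarith
  have mid: "min c1 c2 \<le> c2 + (c1 - c2) * t" "c2 + (c1 - c2) * t \<le> max c1 c2" if "0 \<le> t" "t \<le> 1" for t
  proof -
    have "c2 + (c1 - c2) * t = (1 - t) * c2 + t * c1" by (simp add: algebra_simps)
    moreover have "(1 - t) * c2 \<le> (1 - t) * max c1 c2" "t * c1 \<le> t * max c1 c2"
      "(1 - t) * min c1 c2 \<le> (1 - t) * c2" "t * min c1 c2 \<le> t * c1"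
      using that by (auto intro!: mult_left_mono)
    ultimately show "min c1 c2 \<le> c2 + (c1 - c2) * t" "c2 + (c1 - c2) * t \<le> max c1 c2"
      by (simp_all add: algebra_simps)
  qed
  have s_pos: "s u > 0" for u
    using mid(1)[of "max 0 (min 1 (u - B))"] c D by (auto simp: s_def intro!: mult_pos_pos)
  have s_le: "s u = c2 + (c1 - c2) * max 0 (min 1 (u - B))" if "u \<le> D" for u
    using that D by (simp add: s_def max_absorb1)
  \<comment> \<open>From \<open>A\<close> to \<open>D\<close>, \<open>s \<le> max c1 c2 \<le> A \<le> u \<le> u\<^sup>p\<close>; the last step is the place where \<open>p \<ge> 1\<close> matters.\<close>
  have big: "s u \<le> u powr p" if "A \<le> u" "u \<le> D" for u
  proof -
    have "s u \<le> max c1 c2" using mid(2)[of "max 0 (min 1 (u - B))"] s_le[OF that(2)] by simp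
    also have "\<dots> \<le> u powr 1" using A that by simp
    also have "\<dots> \<le> u powr p" using A that p1 by (intro powr_mono) auto
    finally show ?thesis .
  qed
  have "continuous_on UNIV f"
    unfolding f_def s_def using pq D
    by (intro continuous_intros continuous_on_powr') (auto simp: max_def)
  moreover have "f 0 = 0" using s_pos[of 0] by (simp add: f_def)
  moreover have "f u > 0" if "u > 0" for u using that s_pos[of u] by (simp add: f_def max_def)
  moreover have "((\<lambda>u. f u / u powr p) \<longlongrightarrow> 1) (at_right 0)"
  proof (rule tendsto_eventually)
    have "((\<lambda>u. u powr p) \<longlongrightarrow> 0 powr p) (at_right 0)"
      using pq by (intro tendsto_powr') (auto intro!: tendsto_ident_at eventually_at_right_less[THEN eventually_mono])
    then have "eventually (\<lambda>u. u powr p < min c1 c2) (at_right 0)"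
      using c by (intro order_tendstoD) auto
    moreover have "eventually (\<lambda>u. u \<in> {0<..<D}) (at_right 0)"
      using D by (rule eventually_at_right_real)
    ultimately show "eventually (\<lambda>u. f u / u powr p = 1) (at_right 0)"
    proof eventually_elim
      case (elim u)
      then have "s u \<ge> min c1 c2" using s_le[of u] mid(1)[of "max 0 (min 1 (u - B))"] by simp
      then show ?case using elim by (auto simp: f_def min_def split: if_splits)
    qed
  qed
  moreover have "((\<lambda>u. f u / u powr (- q)) \<longlongrightarrow> c1 * D powr q) at_top"
  proof (rule tendsto_eventually)
    show "eventually (\<lambda>u. f u / u powr (- q) = c1 * D powr q) at_top"
      using eventually_ge_at_top[of D]
    proof eventually_elim
      case (elim u)
      have su: "s u = c1 * (u / D) powr (-q)" using elim B by (simp add: s_def)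
      have "(u / D) powr (-q) \<le> (u / D) powr 0" using elim D q by (intro powr_mono) auto
      then have "(u / D) powr (-q) \<le> 1" using elim D by (auto split: if_splits)
      then have "s u \<le> c1" using su c by simp
      also have "\<dots> \<le> u powr 1" using A elim B by simp
      also have "\<dots> \<le> u powr p" using A B elim p1 by (intro powr_mono) auto
      finally have "f u = s u" using elim D by (simp add: f_def)
      then show ?case using su elim D by (simp add: powr_divide powr_minus field_simps)
    qed
  qed
  moreover have "c1 * D powr q > 0" using c D by simp
  ultimately have "cond_f1 p q f" unfolding cond_f1_def by blast
  moreover have "f u = c2" if "u \<in> {A..B}" for u
    using big[of u] s_le[of u] that A B by (simp add: f_def)
  moreover have "f u = c1" if "u \<in> {B+1..D}" for u
    using big[of u] s_le[of u] that A B by (simp add: f_def)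
  ultimately show ?thesis by blast
qed

section \<open>Integration by parts against BV functions\<close>

lemma finite_measure_leb01: "finite_measure leb01"
  by (intro finite_measureI) (simp add: emeasure_restrict_space)

lemma space_leb01 [simp]: "space leb01 = {0<..<1}"
  by (simp add: space_restrict_space)

lemma integrable_leb01_bounded:
  fixes h :: "real \<Rightarrow> real"
  assumes "h \<in> borel_measurable leb01" "\<And>x. x \<in> {0<..<1} \<Longrightarrow> \<bar>h x\<bar> \<le> K"
  shows "integrable leb01 h"
proof -
  interpret finite_measure leb01 by (rule finite_measure_leb01)
  show ?thesis using assms by (intro integrable_const_bound[where B=K]) auto
qed

lemma continuous_leb01_measurable:
  fixes h :: "real \<Rightarrow> real"
  assumes "continuous_on {0<..<1} h"
  shows "h \<in> borel_measurable leb01" "h \<in> borel_measurable borel01"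
  using assms by (auto intro: continuous_imp_measurable_on_sets_lebesgue borel_measurable_continuous_on_restrict)

text \<open>Written with an indicator, the primitives of different functions at different points are all
  integrals over the same measure space, so dominated convergence applies to them.\<close>

lemma leb01_integral_upto:
  fixes h :: "real \<Rightarrow> real"
  assumes h: "integrable leb01 h" and x: "0 \<le> x" "x \<le> 1"
  shows "(LINT t|leb01. indicator {..x} t * h t) = integral {0..x} h"
proof -
  have *: "(\<lambda>t. indicator {..x} t :: real) \<in> borel_measurable leb01"
    by (intro measurable_restrict_space1 borel_measurable_indicator) simp
  have "integrable leb01 (\<lambda>t. indicator {..x} t * h t)"
    using h by (rule integrable_bounded_mult[where K=1, OF _ *]) (auto simp: indicator_def)
  then have "(LINT t|leb01. indicator {..x} t * h t) = integral {0<..<1} (\<lambda>t. indicator {..x} t * h t)"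
    by (rule lebesgue_integral_eq_integral) simp
  also have "\<dots> = integral {0..1} (\<lambda>t. if t \<in> {..x} then h t else 0)"
    unfolding integral_open_interval_real by (intro integral_cong) (auto simp: indicator_def)
  also have "\<dots> = integral ({..x} \<inter> {0..1}) h" by (rule integral_restrict_Int)
  also have "{..x} \<inter> {0..1} = {0..x}" using x by auto
  finally show ?thesis .
qed

text \<open>Near \<open>0\<close> and near \<open>1\<close> the primitive is constant because its derivative vanishes; the constants are
  \<open>0\<close> on the left by normalisation and on the right because the mean of \<open>g\<close> is zero.\<close>

lemma primitive_is_test_fun:
  fixes g :: "real \<Rightarrow> real"
  assumes g: "continuous_on UNIV g" and \<delta>: "0 < \<delta>" "\<delta> < 1/2"
    and supp: "\<And>x. x < \<delta> \<or> 1 - \<delta> < x \<Longrightarrow> g x = 0"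
    and mean: "integral {0..1} g = 0"
  obtains \<psi> where "test_fun \<psi>" "\<And>x. (\<psi> has_real_derivative g x) (at x)"
    "\<And>x. 0 \<le> x \<Longrightarrow> \<psi> x = integral {0..x} g"
proof -
  have "\<exists>F. \<forall>x::real. (-\<infinity>::ereal) < x \<longrightarrow> x < (\<infinity>::ereal) \<longrightarrow> (F has_vector_derivative g x) (at x)"
    using g by (intro einterval_antiderivative) (auto simp: continuous_on_eq_continuous_at)
  then obtain F where F: "\<And>x. (F has_vector_derivative g x) (at x)" by auto
  define \<psi> where "\<psi> x = F x - F 0" for x
  have der: "(\<psi> has_vector_derivative g x) (at x)" for x
    unfolding \<psi>_def using F[of x] by (auto intro!: derivative_eq_intros)
  have int: "\<psi> x = integral {0..x} g" if "0 \<le> x" for x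
  proof -
    have "(g has_integral (F x - F 0)) {0..x}"
      using F by (intro fundamental_theorem_of_calculus that) (auto intro: has_vector_derivative_at_within)
    then show ?thesis by (simp add: \<psi>_def integral_unique)
  qed
  have const: "\<psi> x = \<psi> y" if "convex S" "\<And>x. x \<in> S \<Longrightarrow> g x = 0" "x \<in> S" "y \<in> S" for S x y
  proof -
    have "\<exists>c. \<forall>x\<in>S. \<psi> x = c"
    proof (rule has_derivative_zero_constant[OF that(1)])
      show "(\<psi> has_derivative (\<lambda>h. 0)) (at x within S)" if "x \<in> S" for x
        using der[of x] \<open>\<And>x. x \<in> S \<Longrightarrow> g x = 0\<close>[OF that]
        by (simp add: has_vector_derivative_def has_derivative_at_withinI)
    qed
    then show ?thesis using that(3,4) by auto
  qed
  have "\<psi> x = 0" if "x < \<delta>" for x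
    using const[of "{..<\<delta>}" x 0] supp that \<delta> by (auto simp: \<psi>_def)
  moreover have "\<psi> x = 0" if "x > 1 - \<delta>" for x
    using const[of "{1-\<delta><..}" x 1] supp that \<delta> int[of 1] mean by auto
  ultimately have "{x. \<psi> x \<noteq> 0} \<subseteq> {\<delta>..1-\<delta>}" by (auto simp: not_less[symmetric])
  then have cl: "closure {x. \<psi> x \<noteq> 0} \<subseteq> {\<delta>..1-\<delta>}" by (rule closure_minimal) simp
  have "test_fun \<psi>"
    unfolding test_fun_def
  proof (intro conjI)
    show "\<psi> C1_differentiable_on UNIV" unfolding C1_differentiable_on_def using der g by auto
    show "compact (closure {x. \<psi> x \<noteq> 0})"
      using cl by (meson bounded_closed_interval bounded_subset closed_closure compact_eq_bounded_closed)
    show "closure {x. \<psi> x \<noteq> 0} \<subseteq> {0<..<1}" using cl \<delta> by force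
  qed
  then show ?thesis using that[of \<psi>] der int by (auto simp: has_real_derivative_iff_has_vector_derivative)
qed

text \<open>A measurable function is an a.e. limit of continuous ones. Truncating these at the bound of \<open>b\<close>
  and multiplying by cutoffs that vanish near the endpoints keeps the limit, and the means then tend
  to the mean of \<open>b\<close>, which is \<open>0\<close>; hence subtracting a multiple of one fixed bump to make each mean
  vanish does not disturb the limit either. The bound \<open>1/4\<close> on the width of the boundary layers leaves
  room for that bump.\<close>

lemma ex_test_derivative_approx:
  fixes b :: "real \<Rightarrow> real"
  assumes b: "b \<in> borel_measurable leb01" and K: "AE x in leb01. \<bar>b x\<bar> \<le> K"
    and mean: "(LINT x|leb01. b x) = 0"
  obtains g :: "nat \<Rightarrow> real \<Rightarrow> real" and C
  where "\<And>n. continuous_on UNIV (g n)" "\<And>n x. \<bar>g n x\<bar> \<le> C"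
    "\<And>n x. x < 1 / (real n + 4) \<or> 1 - 1 / (real n + 4) < x \<Longrightarrow> g n x = 0"
    "\<And>n. (LINT x|leb01. g n x) = 0" "AE x in leb01. (\<lambda>n. g n x) \<longlonglongrightarrow> b x"
proof -
  interpret finite_measure leb01 by (rule finite_measure_leb01)
  define K' where "K' = \<bar>K\<bar>"
  have "b measurable_on {0<..<1}" using b by (simp add: measurable_on_iff_borel_measurable)
  then obtain N G where N: "negligible N" and G: "\<And>n. continuous_on UNIV (G n)"
    and lim: "\<And>x. x \<notin> N \<Longrightarrow> (\<lambda>n. G n x) \<longlonglongrightarrow> (if x \<in> {0<..<1} then b x else 0)"
    unfolding measurable_on_def by blast
  have notN: "AE x in leb01. x \<notin> N"
  proof -
    have "AE x in lebesgue. x \<notin> N" using N by (simp add: negligible_iff_null_sets AE_not_in)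
    then show ?thesis by (subst AE_restrict_space_iff) auto
  qed
  \<comment> \<open>The second factor vanishes at distance less than \<open>1/(n+4)\<close> from the endpoints and is \<open>1\<close> from twice that distance on.\<close>
  define k where "k n x = max (-K') (min K' (G n x)) * max 0 (min 1 ((real n + 4) * min x (1 - x) - 1))"
    for n x
  have kc: "continuous_on UNIV (k n)" for n
    unfolding k_def by (intro continuous_intros G)
  have clamp: "\<bar>max (-K') (min K' t)\<bar> \<le> K'" for t by (auto simp: K'_def)
  have cutoff: "\<bar>max 0 (min 1 t)\<bar> \<le> 1" for t :: real by auto
  have kK: "\<bar>k n x\<bar> \<le> K'" for n x
    using mult_mono[OF clamp cutoff] unfolding k_def abs_mult by (simp add: K'_def)
  have k0: "k n x = 0" if "x < 1 / (real n + 4) \<or> 1 - 1 / (real n + 4) < x" for n x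
  proof -
    have "min x (1 - x) < 1 / (real n + 4)" using that by auto
    then have "(real n + 4) * min x (1 - x) < 1"
      by (simp only: pos_less_divide_eq[of "real n + 4"] mult.commute)
    moreover have "max 0 (min 1 (X - 1)) = 0" if "X < 1" for X :: real using that by auto
    ultimately show ?thesis unfolding k_def by (simp only: mult_zero_right)
  qed
  have klim: "AE x in leb01. (\<lambda>n. k n x) \<longlonglongrightarrow> b x"
    using notN K AE_space[of leb01]
  proof eventually_elim
    case (elim x)
    then have x: "0 < x" "x < 1" by auto
    have "(\<lambda>n. max (-K') (min K' (G n x))) \<longlonglongrightarrow> max (-K') (min K' (b x))"
      using lim[OF elim(1)] x by (intro tendsto_intros) auto
    also have "max (-K') (min K' (b x)) = b x" using elim(2) by (auto simp: K'_def)
    finally have 1: "(\<lambda>n. max (-K') (min K' (G n x))) \<longlonglongrightarrow> b x" .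
    have "eventually (\<lambda>n. n \<ge> nat \<lceil>2 / min x (1 - x)\<rceil>) sequentially"
      by (rule eventually_ge_at_top)
    then have "eventually (\<lambda>n. (real n + 4) * min x (1 - x) \<ge> 2) sequentially"
    proof eventually_elim
      case (elim n)
      then have "2 / min x (1 - x) \<le> real n + 4" by linarith
      then show ?case using x by (subst (asm) pos_divide_le_eq) auto
    qed
    then have "eventually (\<lambda>n. max 0 (min 1 ((real n + 4) * min x (1 - x) - 1)) = 1) sequentially"
      by eventually_elim simp
    then have 2: "(\<lambda>n. max 0 (min 1 ((real n + 4) * min x (1 - x) - 1))) \<longlonglongrightarrow> 1"
      by (rule tendsto_eventually)
    show ?case unfolding k_def using tendsto_mult[OF 1 2] by simp
  qed
  have cint: "integrable leb01 f" if "continuous_on UNIV f" "\<And>x. \<bar>f x\<bar> \<le> C" for f :: "real \<Rightarrow> real" and C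
    using that continuous_on_subset by (intro integrable_leb01_bounded continuous_leb01_measurable) blast+
  have "(\<lambda>n. LINT x|leb01. k n x) \<longlonglongrightarrow> (LINT x|leb01. b x)"
  proof (rule integral_dominated_convergence[where w="\<lambda>_. K'"])
    show "k n \<in> borel_measurable leb01" for n by (rule borel_measurable_integrable[OF cint[OF kc kK]])
  qed (use b klim kK in auto)
  then have m: "(\<lambda>n. LINT x|leb01. k n x) \<longlonglongrightarrow> 0" using mean by simp
  define \<eta> :: "real \<Rightarrow> real" where "\<eta> x = max 0 (1/4 - \<bar>x - 1/2\<bar>)" for x
  have \<eta>c: "continuous_on UNIV \<eta>" unfolding \<eta>_def by (intro continuous_intros)
  have \<eta>b: "0 \<le> \<eta> x" "\<bar>\<eta> x\<bar> \<le> 1" for x by (auto simp: \<eta>_def)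
  define J where "J = (LINT x|leb01. \<eta> x)"
  have "J > 0"
  proof -
    \<comment> \<open>The bump is at least \<open>1/8\<close> on the middle quarter.\<close>
    have "1/8 * measure leb01 {3/8<..<5/8::real} \<le> J"
    proof -
      have s: "{3/8<..<5/8::real} \<in> sets leb01" by (auto simp: sets_restrict_space_iff)
      have "(LINT x|leb01. 1/8 * indicator {3/8<..<5/8::real} x) \<le> J"
        unfolding J_def using s
      proof (intro integral_mono)
        show "integrable leb01 \<eta>" by (rule cint[OF \<eta>c \<eta>b(2)])
        show "integrable leb01 (\<lambda>x. (1/8::real) * indicator {3/8<..<5/8::real} x)"
          using s by (intro integrable_mult_right integrable_real_indicator)
            (auto simp: emeasure_restrict_space sets_restrict_space_iff less_top[symmetric])
      qed (auto simp: \<eta>_def indicator_def abs_if less_top[symmetric])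
      then show ?thesis using s by simp
    qed
    moreover have "measure leb01 {3/8<..<5/8::real} = 1/4" by (subst measure_restrict_space) auto
    ultimately show ?thesis by simp
  qed
  define g where "g n x = k n x - (LINT x|leb01. k n x) / J * \<eta> x" for n x
  have kint: "\<bar>LINT x|leb01. k n x\<bar> \<le> K'" for n
  proof -
    have "\<bar>LINT x|leb01. k n x\<bar> \<le> (LINT x|leb01. \<bar>k n x\<bar>)" by (rule integral_abs_bound)
    also have "\<dots> \<le> (LINT x|leb01. K')" using cint[OF kc kK] kK by (intro integral_mono) auto
    also have "\<dots> = K'" by (simp add: measure_restrict_space)
    finally show ?thesis .
  qed
  show ?thesis
  proof (rule that[of g "K' + K' / J"])
    show "continuous_on UNIV (g n)" for n unfolding g_def by (intro continuous_intros kc \<eta>c)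
    show "\<bar>g n x\<bar> \<le> K' + K' / J" for n x
    proof -
      have "\<bar>(LINT x|leb01. k n x) / J * \<eta> x\<bar> \<le> K' / J * 1"
        unfolding abs_mult using kint[of n] \<eta>b[of x] \<open>J > 0\<close> by (intro mult_mono) (auto simp: divide_right_mono)
      then show ?thesis using kK[of n x] unfolding g_def by linarith
    qed
    show "g n x = 0" if "x < 1 / (real n + 4) \<or> 1 - 1 / (real n + 4) < x" for n x
    proof -
      have "1 / (real n + 4) \<le> 1/4" by (simp add: field_simps)
      then have "x < 1/4 \<or> 3/4 < x" using that by linarith
      then have "\<eta> x = 0" by (auto simp: \<eta>_def)
      then show ?thesis using k0[OF that] by (simp add: g_def)
    qed
    show "(LINT x|leb01. g n x) = 0" for n
      unfolding g_def using cint[OF kc kK] cint[OF \<eta>c \<eta>b(2)] \<open>J > 0\<close> by (simp add: J_def)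
    show "AE x in leb01. (\<lambda>n. g n x) \<longlonglongrightarrow> b x" using klim
    proof eventually_elim
      case (elim x)
      have "(\<lambda>n. k n x - (LINT x|leb01. k n x) / J * \<eta> x) \<longlonglongrightarrow> b x - 0 / J * \<eta> x"
        using \<open>J > 0\<close> by (intro tendsto_intros elim m) auto
      then show ?case by (simp add: g_def)
    qed
  qed
qed

text \<open>The definition of \<open>D\<phi>\<close> tests it only against \<open>C\<^sup>1\<close> functions with compact support. Here the test
  function is merely Lipschitz and vanishes at the endpoints: \<open>w(x) = \<integral>\<^sub>0\<^sup>x b\<close> with \<open>b\<close> bounded of mean
  zero. Approximating \<open>b\<close> boundedly a.e. by derivatives of test functions makes the test functions
  themselves converge to \<open>w\<close> at every point, which is what a measure \<open>D\<phi>\<close> with atoms needs.\<close>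

lemma BV_integration_by_parts:
  fixes b \<phi> :: "real \<Rightarrow> real"
  assumes b: "b \<in> borel_measurable leb01" and K: "AE x in leb01. \<bar>b x\<bar> \<le> K"
    and mean: "(LINT x|leb01. b x) = 0"
    and \<phi>: "integrable leb01 \<phi>" and \<nu>: "derivative_measure \<phi> \<nu>"
  shows "(LINT x|leb01. b x * \<phi> x) = - sm_integral \<nu> (\<lambda>x. integral {0..x} b)"
proof -
  have s\<nu>: "signed_measure01 \<nu>" using \<nu> by (simp add: derivative_measure_def)
  note D = signed_measure01D[OF s\<nu>]
  obtain g C where gc: "\<And>n. continuous_on UNIV (g n)" and gC: "\<And>n x. \<bar>g n x\<bar> \<le> C"
    and g0: "\<And>n x. x < 1 / (real n + 4) \<or> 1 - 1 / (real n + 4) < x \<Longrightarrow> g n x = 0"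
    and gm: "\<And>n. (LINT x|leb01. g n x) = 0" and glim: "AE x in leb01. (\<lambda>n. g n x) \<longlonglongrightarrow> b x"
    using ex_test_derivative_approx[OF b K mean] by blast
  have gmeas: "g n \<in> borel_measurable leb01" for n
    using gc by (intro continuous_leb01_measurable continuous_on_subset[OF gc]) auto
  have gint: "integrable leb01 (g n)" for n by (rule integrable_leb01_bounded[OF gmeas gC])
  have bint: "integrable leb01 b"
  proof -
    interpret finite_measure leb01 by (rule finite_measure_leb01)
    show ?thesis using b K by (intro integrable_const_bound[where B=K]) auto
  qed
  have "\<exists>\<psi>. test_fun \<psi> \<and> (\<forall>x. (\<psi> has_real_derivative g n x) (at x)) \<and>
      (\<forall>x\<ge>0. \<psi> x = integral {0..x} (g n))" for n
  proof -
    have "integral {0..1} (g n) = 0"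
      using gm[of n] lebesgue_integral_eq_integral[OF gint] by (simp add: integral_open_interval_real)
    moreover have "0 < 1 / (real n + 4)" "1 / (real n + 4) < 1/2" by (simp_all add: field_simps)
    ultimately show ?thesis
      using primitive_is_test_fun[OF gc[of n], of "1 / (real n + 4)"] g0[of _ n] by metis
  qed
  then obtain \<psi> where \<psi>: "\<And>n. test_fun (\<psi> n)" and der: "\<And>n x. (\<psi> n has_real_derivative g n x) (at x)"
    and \<psi>int: "\<And>n x. 0 \<le> x \<Longrightarrow> \<psi> n x = integral {0..x} (g n)" by metis
  have "deriv (\<psi> n) = g n" for n using der by (auto intro: DERIV_imp_deriv)
  then have eq: "(LINT x|leb01. \<phi> x * g n x) = - sm_integral \<nu> (\<psi> n)" for n
    using \<nu> \<psi>[of n] by (auto simp: derivative_measure_def)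
  have "(\<lambda>n. LINT x|leb01. \<phi> x * g n x) \<longlonglongrightarrow> (LINT x|leb01. \<phi> x * b x)"
  proof (rule integral_dominated_convergence[where w="\<lambda>x. C * \<bar>\<phi> x\<bar>"])
    show "AE x in leb01. (\<lambda>n. \<phi> x * g n x) \<longlonglongrightarrow> \<phi> x * b x"
      using glim by eventually_elim (intro tendsto_intros)
    show "AE x in leb01. norm (\<phi> x * g n x) \<le> C * \<bar>\<phi> x\<bar>" for n
      using gC[of n] by (intro AE_I2) (simp add: abs_mult mult.commute[of C] mult_left_mono)
  qed (use \<phi> b gmeas in \<open>auto intro!: borel_measurable_times\<close>)
  moreover have "(\<lambda>n. - sm_integral \<nu> (\<psi> n)) \<longlonglongrightarrow> - sm_integral \<nu> (\<lambda>x. integral {0..x} b)"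
  proof -
    have rep: "\<psi> n x = (LINT t|leb01. indicator {..x} t * g n t)" if "x \<in> {0<..<1}" for n x
      using leb01_integral_upto[OF gint, of x n] \<psi>int[of x n] that by simp
    have ind: "(\<lambda>t. indicator {..x} t :: real) \<in> borel_measurable leb01" for x :: real
      by (intro measurable_restrict_space1 borel_measurable_indicator) simp
    have conv: "(\<lambda>n. \<psi> n x) \<longlonglongrightarrow> integral {0..x} b" if "x \<in> {0<..<1}" for x
    proof -
      have "(\<lambda>n. LINT t|leb01. indicator {..x} t * g n t) \<longlonglongrightarrow> (LINT t|leb01. indicator {..x} t * b t)"
      proof (rule integral_dominated_convergence[where w="\<lambda>_. C"])
        show "integrable leb01 (\<lambda>_. C)" using finite_measure_leb01 by (simp add: finite_measure.integrable_const)
        show "AE t in leb01. (\<lambda>n. indicator {..x} t * g n t) \<longlonglongrightarrow> indicator {..x} t * b t"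
          using glim by eventually_elim (intro tendsto_intros)
        show "AE t in leb01. norm (indicator {..x} t * g n t) \<le> C" for n
        proof (intro AE_I2)
          fix t
          have "0 \<le> C" using gC[of n t] by simp
          then show "norm (indicator {..x} t * g n t) \<le> C" using gC[of n t] by (auto simp: indicator_def)
        qed
      qed (use ind b gmeas in \<open>auto intro!: borel_measurable_times\<close>)
      then show ?thesis using leb01_integral_upto[OF bint, of x] that by (simp add: rep)
    qed
    have bound: "\<bar>\<psi> n x\<bar> \<le> C" if "x \<in> {0<..<1}" for n x
    proof -
      have "norm (integral {0..x} (g n)) \<le> C * (x - 0)"
        using gC[of n] that by (intro integral_bound continuous_on_subset[OF gc]) auto
      also have "\<dots> \<le> C" using that order_trans[OF abs_ge_zero gC[of n x]] by (simp add: mult_left_le)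
      finally show ?thesis using \<psi>int[of x n] that by simp
    qed
    have \<psi>meas: "\<psi> n \<in> borel_measurable borel01" for n
      using der by (intro continuous_leb01_measurable) (auto intro: DERIV_isCont continuous_at_imp_continuous_on)
    have *: "(\<lambda>n. LINT x|M. \<psi> n x) \<longlonglongrightarrow> (LINT x|M. integral {0..x} b)"
      if M: "finite_measure M" "sets M = sets borel01" for M
    proof (rule integral_dominated_convergence[where w="\<lambda>_. C"])
      have sp: "space M = {0<..<1}" using sets_eq_imp_space_eq[OF M(2)] by simp
      show "integrable M (\<lambda>_. C)" using M by (simp add: finite_measure.integrable_const)
      show m: "\<psi> n \<in> borel_measurable M" for n using \<psi>meas M(2) by (simp cong: measurable_cong_sets)
      show "(\<lambda>x. integral {0..x} b) \<in> borel_measurable M"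
        by (rule borel_measurable_LIMSEQ_real[where u=\<psi>, OF _ m]) (use conv sp in auto)
      show "AE x in M. (\<lambda>n. \<psi> n x) \<longlonglongrightarrow> integral {0..x} b" using conv sp by (intro AE_I2) auto
      show "AE x in M. norm (\<psi> n x) \<le> C" for n using bound sp by (intro AE_I2) auto
    qed
    show ?thesis unfolding sm_integral_def by (intro tendsto_intros *) (use D in auto)
  qed
  ultimately show ?thesis unfolding eq using LIMSEQ_unique by (fastforce simp: mult.commute)
qed

section \<open>Decreasing functions with one jump\<close>

lemma test_funD:
  assumes "test_fun \<psi>"
  obtains "continuous_on UNIV (deriv \<psi>)" "\<And>x. (\<psi> has_real_derivative deriv \<psi> x) (at x)"
    "continuous_on UNIV \<psi>" "\<psi> 0 = 0" "\<psi> 1 = 0"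
proof -
  obtain D where D: "\<And>x. (\<psi> has_vector_derivative D x) (at x)" "continuous_on UNIV D"
    using assms unfolding test_fun_def C1_differentiable_on_def by auto
  then have der: "(\<psi> has_real_derivative D x) (at x)" for x
    by (simp add: has_real_derivative_iff_has_vector_derivative)
  then have "deriv \<psi> = D" by (auto intro: DERIV_imp_deriv)
  moreover have "continuous_on UNIV \<psi>"
    using der by (auto intro: DERIV_isCont continuous_at_imp_continuous_on)
  moreover have "\<psi> x = 0" if "x \<notin> {0<..<1}" for x
    using assms that closure_subset[of "{x. \<psi> x \<noteq> 0}"] unfolding test_fun_def by blast
  ultimately show ?thesis using that D der by simp
qed

lemma continuous_bounded01:
  fixes h :: "real \<Rightarrow> real"
  assumes "continuous_on {0..1} h"
  obtains K where "\<And>x. x \<in> {0<..<1} \<Longrightarrow> \<bar>h x\<bar> \<le> K"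
proof -
  have "compact (h ` {0..1})" using assms by (intro compact_continuous_image) auto
  then obtain K where "\<forall>y\<in>h ` {0..1}. norm y \<le> K"
    using compact_imp_bounded bounded_iff by blast
  then show ?thesis using that[of K] by auto
qed

lemma leb01_integrable_imp_integrable_on:
  fixes h :: "real \<Rightarrow> real"
  assumes "integrable leb01 h"
  shows "h integrable_on {0..1}"
  using has_integral_integral_lebesgue_on[OF assms]
  by (auto simp: has_integral_integrable integrable_on_open_interval_real[symmetric])

lemma step_measurable:
  fixes z :: real
  shows "(\<lambda>x. if x \<le> z then 1 else 0 :: real) \<in> borel_measurable leb01"
proof -
  have "(\<lambda>x. if x \<le> z then 1 else 0 :: real) = indicator {..z}" by (auto simp: indicator_def)
  then show ?thesis by (simp only:) (intro measurable_restrict_space1 borel_measurable_indicator, simp)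
qed

text \<open>The function with \<open>u' = -g\<close> off \<open>z\<close>, a unit drop at \<open>z\<close>, and \<open>u(0) = c + 1\<close>.\<close>

definition jump_function :: "real \<Rightarrow> (real \<Rightarrow> real) \<Rightarrow> real \<Rightarrow> real \<Rightarrow> real" where
  "jump_function c g z x = c - integral {0..x} g + (if x \<le> z then 1 else 0)"

context
  fixes g :: "real \<Rightarrow> real" and z c :: real
  assumes z: "0 < z" "z < 1"
    and g: "integrable leb01 g" and gc: "\<And>x. x \<in> {0<..<1} - {z} \<Longrightarrow> isCont g x"
    and g0: "\<And>x. x \<in> {0<..<1} \<Longrightarrow> 0 \<le> g x"
begin

lemma primitive_continuous: "continuous_on {0..1} (\<lambda>x. c - integral {0..x} g)"
  by (intro continuous_intros indefinite_integral_continuous_1 leb01_integrable_imp_integrable_on[OF g])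

lemma jump_function_measurable: "jump_function c g z \<in> borel_measurable leb01"
  unfolding jump_function_def[abs_def]
  by (intro borel_measurable_add step_measurable continuous_leb01_measurable continuous_on_subset[OF primitive_continuous]) auto

lemma jump_function_integrable: "integrable leb01 (jump_function c g z)"
proof -
  obtain K where K: "\<And>x. x \<in> {0<..<1} \<Longrightarrow> \<bar>c - integral {0..x} g\<bar> \<le> K"
    using continuous_bounded01[OF primitive_continuous] by blast
  show ?thesis
    by (rule integrable_leb01_bounded[OF jump_function_measurable, of "K + 1"])
      (use K in \<open>fastforce simp: jump_function_def\<close>)
qed

text \<open>Classical integration by parts handles the continuous part, the point \<open>z\<close>, where \<open>g\<close> may fail to
  be continuous, being an admissible exception; the step contributes \<open>\<integral>\<^sub>0\<^sup>z \<psi>' = \<psi>(z)\<close>.\<close>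

lemma jump_function_weak_derivative:
  assumes \<psi>: "test_fun \<psi>"
  shows "(LINT x|leb01. jump_function c g z x * deriv \<psi> x) = (LINT x|leb01. \<psi> x * g x) + \<psi> z"
proof -
  obtain dc: "continuous_on UNIV (deriv \<psi>)" and der: "\<And>x. (\<psi> has_real_derivative deriv \<psi> x) (at x)"
    and \<psi>c: "continuous_on UNIV \<psi>" and ends: "\<psi> 0 = 0" "\<psi> 1 = 0"
    using test_funD[OF \<psi>] by blast
  obtain K where K: "\<And>x. x \<in> {0<..<1} \<Longrightarrow> \<bar>deriv \<psi> x\<bar> \<le> K"
    using continuous_bounded01[OF continuous_on_subset[OF dc]] by blast
  obtain L where L: "\<And>x. x \<in> {0<..<1} \<Longrightarrow> \<bar>\<psi> x\<bar> \<le> L"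
    using continuous_bounded01[OF continuous_on_subset[OF \<psi>c]] by blast
  define U where "U x = c - integral {0..x} g" for x
  have Uder: "(U has_vector_derivative - g x) (at x)" if x: "x \<in> {0<..<1} - {z}" for x
  proof -
    have "((\<lambda>u. integral {0..u} g) has_vector_derivative g x) (at x within {0..1} - {})"
      using x gc[OF x] by (intro integral_has_vector_derivative_continuous_at leb01_integrable_imp_integrable_on[OF g])
        (auto intro: continuous_at_imp_continuous_within)
    then have "((\<lambda>u. integral {0..u} g) has_vector_derivative g x) (at x)"
      using x at_within_interior[of x "{0..1}"] by auto
    then show ?thesis unfolding U_def by (auto intro!: derivative_eq_intros)
  qed
  have "integrable leb01 (\<lambda>x. \<psi> x * g x)"
    using \<psi>c L by (intro integrable_bounded_mult[OF g, of _ L] continuous_leb01_measurable)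
      (auto intro: continuous_on_subset)
  then have "((\<lambda>x. \<psi> x * g x) has_integral (LINT x|leb01. \<psi> x * g x)) {0<..<1}"
    by (intro has_integral_integral_lebesgue_on) auto
  then have I: "((\<lambda>x. \<psi> x * g x) has_integral (LINT x|leb01. \<psi> x * g x)) {0..1}"
    by (simp add: has_integral_Icc_iff_Ioo)
  \<comment> \<open>The boundary terms vanish because \<open>\<psi>\<close> does, and \<open>U' = -g\<close> turns the minus sign around.\<close>
  have 1: "((\<lambda>x. deriv \<psi> x * U x) has_integral (LINT x|leb01. \<psi> x * g x)) {0..1}"
  proof (rule integration_by_parts_interior_strong[OF bounded_bilinear_mult, of "{z}" 0 1 \<psi> U])
    show "((\<lambda>x. \<psi> x * - g x) has_integral \<psi> 1 * U 1 - \<psi> 0 * U 0 - (LINT x|leb01. \<psi> x * g x)) {0..1}"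
      using has_integral_neg[OF I] ends by simp
    show "continuous_on {0..1} U" unfolding U_def by (rule primitive_continuous)
  qed (use \<psi>c der Uder in \<open>auto intro: continuous_on_subset simp: has_real_derivative_iff_has_vector_derivative\<close>)
  have "(deriv \<psi> has_integral (\<psi> z - \<psi> 0)) {0..z}"
    using der z by (intro fundamental_theorem_of_calculus)
      (auto intro: has_vector_derivative_at_within simp: has_real_derivative_iff_has_vector_derivative)
  then have "((\<lambda>x. if x \<in> {0..z} then deriv \<psi> x else 0) has_integral \<psi> z) {0..1}"
    using z ends by (subst has_integral_restrict) auto
  then have "((\<lambda>x. deriv \<psi> x * (if x \<le> z then 1 else 0)) has_integral \<psi> z) {0..1}"
    by (rule has_integral_cong[THEN iffD1, rotated]) auto
  from has_integral_add[OF 1 this]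
  have "((\<lambda>x. deriv \<psi> x * jump_function c g z x) has_integral (LINT x|leb01. \<psi> x * g x) + \<psi> z) {0..1}"
    by (simp add: jump_function_def U_def algebra_simps)
  then have "((\<lambda>x. deriv \<psi> x * jump_function c g z x) has_integral (LINT x|leb01. \<psi> x * g x) + \<psi> z) {0<..<1}"
    by (simp add: has_integral_Icc_iff_Ioo)
  moreover have "integrable leb01 (\<lambda>x. deriv \<psi> x * jump_function c g z x)"
    using dc K by (intro integrable_bounded_mult[OF jump_function_integrable, of _ K] continuous_leb01_measurable)
      (auto intro: continuous_on_subset)
  ultimately have "(LINT x|leb01. deriv \<psi> x * jump_function c g z x) = (LINT x|leb01. \<psi> x * g x) + \<psi> z"
    by (simp add: lebesgue_integral_eq_integral integral_unique)
  then show ?thesis by (simp add: mult.commute)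
qed

text \<open>The measure \<open>g dx\<close>, restricted to the Borel sets by pushing it forward along the identity.\<close>

definition slope_measure :: "real measure" where
  "slope_measure = distr (density leb01 (\<lambda>x. ennreal (g x))) borel01 (\<lambda>x. x)"

lemma ident_measurable: "(\<lambda>x. x) \<in> measurable leb01 borel01"
  using borel01_subset_leb01 by (auto simp: measurable_def sets_borel01_iff sets.Int_space_eq2[symmetric])

lemma emeasure_slope_measure:
  assumes "B \<in> sets borel01"
  shows "emeasure slope_measure B = ennreal (LINT x:B|leb01. g x)"
proof -
  have Bs: "B \<in> sets leb01" using assms borel01_subset_leb01 by auto
  have B: "B \<inter> {0<..<1} = B" using assms by (auto simp: sets_borel01_iff)
  have "emeasure slope_measure B = emeasure (density leb01 (\<lambda>x. ennreal (g x))) B"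
    unfolding slope_measure_def using assms ident_measurable B by (subst emeasure_distr) auto
  also have "\<dots> = (\<integral>\<^sup>+x. ennreal (g x) * indicator B x \<partial>leb01)"
    using Bs g by (subst emeasure_density) auto
  also have "\<dots> = (\<integral>\<^sup>+x. ennreal (indicator B x * g x) \<partial>leb01)"
    by (intro nn_integral_cong) (auto simp: indicator_def)
  also have "\<dots> = ennreal (LINT x|leb01. indicator B x * g x)"
    using g g0 Bs by (intro nn_integral_eq_integral integrable_bounded_mult[where K=1] AE_I2)
      (auto simp: indicator_def)
  finally show ?thesis by (simp add: set_lebesgue_integral_def)
qed

lemma set_integral_g_nonneg: "0 \<le> (LINT x:B|leb01. g x)"
  unfolding set_lebesgue_integral_def using g0 by (intro integral_nonneg_AE AE_I2) auto

lemma sets_slope_measure: "sets slope_measure = sets borel01" by (simp add: slope_measure_def)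

lemma integral_slope_measure:
  assumes "h \<in> borel_measurable borel01"
  shows "(LINT x|slope_measure. h x) = (LINT x|leb01. h x * g x)"
proof -
  have hm: "h \<in> borel_measurable leb01"
    by (rule borel01_measurable_mono[OF assms]) (use borel01_subset_leb01 in auto)
  have "(LINT x|slope_measure. h x) = (LINT x|density leb01 (\<lambda>x. ennreal (g x)). h x)"
    unfolding slope_measure_def using assms ident_measurable by (subst integral_distr) auto
  also have "\<dots> = (LINT x|leb01. g x * h x)"
    using g g0 hm by (subst integral_real_density) (auto intro!: AE_I2)
  finally show ?thesis by (simp add: mult.commute)
qed

text \<open>\<open>-Du = g dx + \<delta>\<^sub>z\<close> is a positive measure since \<open>u\<close> decreases, so the Jordan decomposition of \<open>Du\<close>
  has no positive part. The sum of two mutually singular measures is a total variation.\<close>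

abbreviation neg_derivative :: "real measure" where
  "neg_derivative \<equiv> variation (slope_measure, return borel01 z)"

lemma jump_point_sets: "{z} \<in> sets borel01" "z \<in> space borel01" "{0<..<1} - {z} \<in> sets borel01"
  using z by (auto simp: sets_borel01_iff)

lemma slope_measure_finite: "finite_measure slope_measure"
proof (rule finite_measureI)
  have "space slope_measure = {0<..<1}" by (simp add: slope_measure_def)
  then show "emeasure slope_measure (space slope_measure) \<noteq> \<infinity>"
    using emeasure_slope_measure[of "{0<..<1}"] by (simp add: sets_borel01_iff)
qed

lemma neg_derivative_parts_signed: "signed_measure01 (slope_measure, return borel01 z)"
proof -
  have "emeasure slope_measure {z} = 0"
  proof -
    have "AE x in leb01. x \<noteq> z"
      by (subst AE_restrict_space_iff) (auto intro!: AE_I'[of "{z}"])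
    then have "(LINT x:{z}|leb01. g x) = 0"
      unfolding set_lebesgue_integral_def by (intro integral_eq_zero_AE) (auto elim: eventually_mono)
    then show ?thesis using emeasure_slope_measure[OF jump_point_sets(1)] by simp
  qed
  moreover have "emeasure (return borel01 z) ({0<..<1} - {z}) = 0" using jump_point_sets by simp
  moreover have "{0<..<1} - ({0<..<1} - {z}) = {z}" using z by auto
  ultimately have "\<exists>A\<in>sets borel01. emeasure (return borel01 z) A = 0 \<and>
      emeasure slope_measure ({0<..<1} - A) = 0"
    using jump_point_sets(3) by (intro bexI[where x="{0<..<1} - {z}"]) simp_all
  then show ?thesis
    using slope_measure_finite sets_slope_measure prob_space.finite_measure[OF prob_space_return[OF jump_point_sets(2)]]
    by (simp add: signed_measure01_def)
qed

lemma negated_measure_signed: "signed_measure01 (null_measure borel01, neg_derivative)"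
  "signed_measure01 (null_measure borel01, return borel01 z)"
proof -
  have neg: "signed_measure01 (null_measure borel01, N)"
    if "finite_measure N" "sets N = sets borel01" for N
  proof -
    have "finite_measure (null_measure borel01 :: real measure)" by (rule finite_measureI) simp
    moreover have "\<exists>A\<in>sets borel01. emeasure N A = 0 \<and>
        emeasure (null_measure borel01) ({0<..<1} - A) = 0"
      by (rule bexI[where x="{}"]) simp_all
    ultimately show ?thesis using that by (simp add: signed_measure01_def)
  qed
  show "signed_measure01 (null_measure borel01, neg_derivative)"
    by (rule neg[OF finite_measure_variation[OF neg_derivative_parts_signed]]) simp
  show "signed_measure01 (null_measure borel01, return borel01 z)"
    by (rule neg[OF prob_space.finite_measure[OF prob_space_return[OF jump_point_sets(2)]]]) simp
qed

lemma jump_function_derivative_measure: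
  "derivative_measure (jump_function c g z) (null_measure borel01, neg_derivative)"
  unfolding derivative_measure_def
proof (intro conjI allI impI negated_measure_signed)
  fix \<psi> assume \<psi>: "test_fun \<psi>"
  obtain \<psi>c: "continuous_on UNIV \<psi>" using test_funD[OF \<psi>] by blast
  obtain L where L: "\<And>x. x \<in> {0<..<1} \<Longrightarrow> \<bar>\<psi> x\<bar> \<le> L"
    using continuous_bounded01[OF continuous_on_subset[OF \<psi>c]] by blast
  have m: "\<psi> \<in> borel_measurable borel01"
    by (intro continuous_leb01_measurable continuous_on_subset[OF \<psi>c]) auto
  show "(LINT x|leb01. jump_function c g z x * deriv \<psi> x) = - sm_integral (null_measure borel01, neg_derivative) \<psi>"
    using jump_function_weak_derivative[OF \<psi>] integral_variation[OF neg_derivative_parts_signed m L]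
      integral_slope_measure[OF m] integral_return[OF jump_point_sets(2) m]
    by (simp add: sm_integral_def)
qed

lemma jump_function_decomposition:
  "lebesgue_decomposition (null_measure borel01, neg_derivative) (\<lambda>x. - g x) (null_measure borel01, return borel01 z)"
proof -
  have "sm_val (null_measure borel01, neg_derivative) B
      = (LINT x:B|leb01. - g x) + sm_val (null_measure borel01, return borel01 z) B"
    if B: "B \<in> sets borel01" for B
  proof -
    have "measure slope_measure B = (LINT x:B|leb01. g x)"
      using emeasure_slope_measure[OF B] set_integral_g_nonneg by (simp add: measure_def)
    moreover have "(LINT x:B|leb01. - g x) = - (LINT x:B|leb01. g x)"
      by (simp add: set_lebesgue_integral_def)
    ultimately show ?thesis
      using measure_variation[OF neg_derivative_parts_signed B] B by (simp add: sm_val_def)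
  qed
  moreover have "emeasure (variation (null_measure borel01, return borel01 z)) ({0<..<1} - {z}) = 0"
    using emeasure_variation[OF negated_measure_signed(2) jump_point_sets(3)] jump_point_sets by simp
  then have "\<exists>A\<in>sets borel01. emeasure lborel A = 0 \<and>
      emeasure (variation (null_measure borel01, return borel01 z)) ({0<..<1} - A) = 0"
    using jump_point_sets(1) by (intro bexI[where x="{z}"]) auto
  ultimately show ?thesis
    unfolding lebesgue_decomposition_def using negated_measure_signed(2) g by auto
qed

lemma jump_function_sm_density:
  "sm_density (null_measure borel01, return borel01 z)
    (variation (null_measure borel01, return borel01 z)) (\<lambda>x. -1)"
proof -
  note fin = finite_measure_variation[OF negated_measure_signed(2)]
  show ?thesis unfolding sm_density_def
  proof (intro conjI ballI)
    show "integrable (variation (null_measure borel01, return borel01 z)) (\<lambda>x. -1 :: real)"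
      by (rule finite_measure.integrable_const[OF fin])
    fix B assume B: "B \<in> sets borel01"
    show "sm_val (null_measure borel01, return borel01 z) B
        = (LINT x:B|variation (null_measure borel01, return borel01 z). -1)"
      using set_integral_const_measure[OF fin, of B "-1"] measure_variation[OF negated_measure_signed(2) B] B
      by (simp add: sm_val_def)
  qed
qed

text \<open>A measure that is absolutely continuous with respect to \<open>\<delta>\<^sub>z\<close> sees only the value at \<open>z\<close>, and there
  \<open>-w\<close> agrees with the density \<open>-1\<close> of \<open>Du\<^sup>s\<close>.\<close>

lemma sm_integral_on_jump:
  assumes \<sigma>: "signed_measure01 \<sigma>"
    and ac: "absolutely_continuous (variation (null_measure borel01, return borel01 z)) (variation \<sigma>)"
    and w: "w \<in> borel_measurable borel01" "w z = 1"
  shows "sm_integral \<sigma> (\<lambda>x. -1) = - sm_integral \<sigma> w"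
proof -
  have "{0<..<1} - {z} \<in> null_sets (variation (null_measure borel01, return borel01 z))"
    using emeasure_variation[OF negated_measure_signed(2) jump_point_sets(3)] jump_point_sets by (simp add: null_sets_def)
  then have "emeasure (variation \<sigma>) ({0<..<1} - {z}) = 0"
    using ac by (auto simp: absolutely_continuous_def)
  then have e: "emeasure (fst \<sigma>) ({0<..<1} - {z}) = 0" "emeasure (snd \<sigma>) ({0<..<1} - {z}) = 0"
    using emeasure_variation[OF \<sigma> jump_point_sets(3)] by auto
  have *: "(LINT x|M. -1) = - (LINT x|M. w x)"
    if M: "sets M = sets borel01" "emeasure M ({0<..<1} - {z}) = 0" for M
  proof -
    have sp: "space M = {0<..<1}" using sets_eq_imp_space_eq[OF M(1)] by simp
    have "AE x in M. x = z"
      using M jump_point_sets sp by (intro AE_I'[of "{0<..<1} - {z}"]) (auto simp: null_sets_def)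
    then have "AE x in M. -1 = - w x" by eventually_elim (simp add: w)
    then have "(LINT x|M. -1) = (LINT x|M. - w x)"
      using w M(1) by (intro integral_cong_AE) (auto cong: measurable_cong_sets)
    then show ?thesis by simp
  qed
  show ?thesis
    unfolding sm_integral_def using *[OF _ e(1)] *[OF _ e(2)] signed_measure01D[OF \<sigma>] by simp
qed

text \<open>With the flux \<open>w = -u' / sqrt(1 + u'\<^sup>2)\<close> the equation reads \<open>w' = \<lambda> a f(u)\<close>, and the boundary
  conditions say that \<open>w\<close> vanishes at \<open>0\<close> and \<open>1\<close>. Testing with \<open>\<phi>\<close> and integrating by parts moves the
  derivative from \<open>w\<close> to \<open>\<phi>\<close>; the part on \<open>D\<phi>\<^sup>a\<close> is the absolutely continuous part of the weak
  formulation, and on \<open>D\<phi>\<^sup>s\<close>, an atom at \<open>z\<close>, the flux takes the value \<open>1\<close> that a vertical slope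
  demands.\<close>

lemma jump_function_bv_solution:
  fixes a f :: "real \<Rightarrow> real" and lam :: real
  defines "b \<equiv> \<lambda>x. lam * a x * f (jump_function c g z x)"
  defines "w \<equiv> \<lambda>x. integral {0..x} b"
  assumes b: "b \<in> borel_measurable leb01" "AE x in leb01. \<bar>b x\<bar> \<le> K" "(LINT x|leb01. b x) = 0"
    and wz: "w z = 1" and gw: "\<And>x. x \<in> {0<..<1} - {z} \<Longrightarrow> g x / sqrt (1 + (g x)\<^sup>2) = w x"
    and wc: "continuous_on {0..1} w"
  shows "bv_solution a f lam (jump_function c g z)"
proof -
  let ?us = "(null_measure borel01, return borel01 z)"
  obtain K' where K': "\<And>x. x \<in> {0<..<1} \<Longrightarrow> \<bar>w x\<bar> \<le> K'" using continuous_bounded01[OF wc] by blast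
  have wm: "w \<in> borel_measurable borel01" "w \<in> borel_measurable leb01"
    using continuous_leb01_measurable[OF continuous_on_subset[OF wc]] by (simp_all add: greaterThanLessThan_subseteq_atLeastAtMost_iff)
  have BV: "jump_function c g z \<in> BV01"
    unfolding BV01_def using jump_function_integrable jump_function_derivative_measure by blast
  have parts: "derivative_parts (jump_function c g z) (\<lambda>x. - g x) ?us"
    unfolding derivative_parts_def using jump_function_derivative_measure jump_function_decomposition by blast
  have "(LINT x|leb01. - g x * \<phi>a x / sqrt (1 + (- g x)\<^sup>2)) + sm_integral \<phi>s (\<lambda>x. -1) =
        (LINT x|leb01. lam * a x * f (jump_function c g z x) * \<phi> x)"
    if \<phi>: "\<phi> \<in> BV01" and \<phi>p: "derivative_parts \<phi> \<phi>a \<phi>s"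
      and ac: "absolutely_continuous (variation ?us) (variation \<phi>s)" for \<phi> \<phi>a \<phi>s
  proof -
    obtain \<nu> where \<nu>: "derivative_measure \<phi> \<nu>" and dec: "lebesgue_decomposition \<nu> \<phi>a \<phi>s"
      using \<phi>p by (auto simp: derivative_parts_def)
    have s: "signed_measure01 \<nu>" "signed_measure01 \<phi>s" and \<phi>a: "integrable leb01 \<phi>a"
      using \<nu> dec by (auto simp: derivative_measure_def lebesgue_decomposition_def)
    have "AE x in leb01. x \<noteq> z"
      by (subst AE_restrict_space_iff) (auto intro!: AE_I'[of "{z}"])
    then have "AE x in leb01. - g x * \<phi>a x / sqrt (1 + (- g x)\<^sup>2) = - (w x * \<phi>a x)"
      using AE_space by eventually_elim (use gw in \<open>force simp flip: gw\<close>)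
    moreover note [measurable] = borel_measurable_integrable[OF g] borel_measurable_integrable[OF \<phi>a] wm(2)
    have "(\<lambda>x. - g x * \<phi>a x / sqrt (1 + (- g x)\<^sup>2)) \<in> borel_measurable leb01" by measurable
    moreover have "(\<lambda>x. - (w x * \<phi>a x)) \<in> borel_measurable leb01" by measurable
    ultimately have "(LINT x|leb01. - g x * \<phi>a x / sqrt (1 + (- g x)\<^sup>2)) = (LINT x|leb01. - (w x * \<phi>a x))"
      by (intro integral_cong_AE)
    moreover have "sm_integral \<nu> w = (LINT x|leb01. w x * \<phi>a x) + sm_integral \<phi>s w"
      by (rule sm_integral_decomposition[OF s(1) dec wm(1) K'])
    moreover have "(LINT x|leb01. b x * \<phi> x) = - sm_integral \<nu> w"
      unfolding w_def using \<phi> by (intro BV_integration_by_parts[OF b _ \<nu>]) (auto simp: BV01_def)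
    moreover have "sm_integral \<phi>s (\<lambda>x. -1) = - sm_integral \<phi>s w"
      by (rule sm_integral_on_jump[where w=w, OF s(2) ac wm(1) wz])
    ultimately show ?thesis by (simp add: b_def)
  qed
  then show ?thesis
    unfolding bv_solution_def using BV parts jump_function_sm_density by blast
qed

end

section \<open>Singularity and positivity\<close>

lemma has_real_derivative_pos_part_square:
  "((\<lambda>y::real. (max 0 y)\<^sup>2) has_real_derivative 2 * max 0 x) (at x)"
proof -
  consider "x > 0" | "x < 0" | "x = 0" by linarith
  then show ?thesis
  proof cases
    case 1
    have "((\<lambda>y. y\<^sup>2) has_real_derivative 2 * max 0 x) (at x)"
      using 1 by (auto intro!: derivative_eq_intros)
    then show ?thesis
      by (rule DERIV_cong_ev[OF refl _ refl, THEN iffD1, rotated])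
        (use 1 eventually_nhds_in_open[of "{0<..}" x] in \<open>auto elim: eventually_mono\<close>)
  next
    case 2
    have "((\<lambda>y. 0) has_real_derivative 2 * max 0 x) (at x)"
      using 2 by (auto intro!: derivative_eq_intros)
    then show ?thesis
      by (rule DERIV_cong_ev[OF refl _ refl, THEN iffD1, rotated])
        (use 2 eventually_nhds_in_open[of "{..<0}" x] in \<open>auto elim: eventually_mono\<close>)
  next
    case 3
    have "((\<lambda>h::real. (max 0 h)\<^sup>2 / h) \<longlongrightarrow> 0) (at 0)"
    proof (rule tendsto_rabs_zero_cancel, rule tendsto_sandwich[of "\<lambda>_. 0" _ _ "\<lambda>h. \<bar>h\<bar>"])
      show "eventually (\<lambda>h::real. \<bar>(max 0 h)\<^sup>2 / h\<bar> \<le> \<bar>h\<bar>) (at 0)"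
        by (intro always_eventually allI) (auto simp: max_def power2_eq_square)
      show "((\<lambda>h::real. \<bar>h\<bar>) \<longlongrightarrow> 0) (at 0)" by (intro tendsto_rabs_zero tendsto_ident_at)
    qed auto
    then show ?thesis using 3 by (simp add: DERIV_def)
  qed
qed

text \<open>The functions \<open>((1 - k\<^sup>2 (x - z)\<^sup>2)\<^sup>+)\<^sup>2\<close> with \<open>k\<close> growing: the outer square makes the positive part
  continuously differentiable.\<close>

lemma ex_test_funs_concentrating:
  assumes z: "0 < z" "z < (1::real)"
  obtains \<psi> :: "nat \<Rightarrow> real \<Rightarrow> real" where "\<And>n. test_fun (\<psi> n)" "\<And>n x. \<bar>\<psi> n x\<bar> \<le> 1"
    "\<And>n. \<psi> n z = 1" "\<And>x. x \<noteq> z \<Longrightarrow> (\<lambda>n. \<psi> n x) \<longlonglongrightarrow> 0"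
proof -
  define r where "r = min z (1 - z)"
  have r: "0 < r" "r \<le> z" "r \<le> 1 - z" using z by (auto simp: r_def)
  \<comment> \<open>The summand \<open>2/r\<close> keeps the support, an interval of radius \<open>1/k\<close> about \<open>z\<close>, inside \<open>(0,1)\<close> from the start.\<close>
  define k where "k n = real n + 2 / r" for n
  have k: "k n > 0" "1 / k n < r" "k n \<ge> real n" for n
  proof -
    show "k n > 0" using r by (auto simp: k_def intro: add_nonneg_pos)
    show "k n \<ge> real n" using r by (simp add: k_def)
    have "k n * r = real n * r + 2" using r by (simp add: k_def distrib_right)
    moreover have "0 \<le> real n * r" using r by simp
    ultimately have "1 < k n * r" by linarith
    then show "1 / k n < r" using \<open>k n > 0\<close> by (simp add: field_simps)
  qed
  define \<psi> where "\<psi> n x = (max 0 (1 - (k n * (x - z))\<^sup>2))\<^sup>2" for n x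
  have small: "\<bar>x - z\<bar> \<le> 1 / k n" if "\<psi> n x \<noteq> 0" for n x
  proof -
    have "(k n * (x - z))\<^sup>2 < 1" using that by (auto simp: \<psi>_def max_def split: if_splits)
    then have "\<bar>k n * (x - z)\<bar> < 1" by (simp add: abs_square_less_1)
    then have "k n * \<bar>x - z\<bar> \<le> 1" using k(1)[of n] unfolding abs_mult by simp
    then show ?thesis using k(1)[of n] by (subst pos_le_divide_eq) (auto simp: mult.commute)
  qed
  have cl: "closure {x. \<psi> n x \<noteq> 0} \<subseteq> {z - 1 / k n .. z + 1 / k n}" for n
    using small[of n] by (intro closure_minimal) (auto simp: abs_le_iff algebra_simps)
  show ?thesis
  proof (rule that[of \<psi>])
    fix n
    show "test_fun (\<psi> n)"
      unfolding test_fun_def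
    proof (intro conjI)
      define D where "D x = 2 * max 0 (1 - (k n * (x - z))\<^sup>2) * (- 2 * (k n * (x - z)) * k n)" for x
      have "((\<lambda>x. 1 - (k n * (x - z))\<^sup>2) has_real_derivative - 2 * (k n * (x - z)) * k n) (at x)" for x
        by (auto intro!: derivative_eq_intros simp: power2_eq_square)
      from DERIV_chain2[OF has_real_derivative_pos_part_square this]
      have "(\<psi> n has_real_derivative D x) (at x)" for x unfolding \<psi>_def D_def .
      moreover have "continuous_on UNIV D" unfolding D_def by (intro continuous_intros)
      ultimately show "\<psi> n C1_differentiable_on UNIV"
        unfolding C1_differentiable_on_def has_real_derivative_iff_has_vector_derivative by blast
      show "compact (closure {x. \<psi> n x \<noteq> 0})"
        using cl[of n] by (meson bounded_closed_interval bounded_subset closed_closure compact_eq_bounded_closed)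
      show "closure {x. \<psi> n x \<noteq> 0} \<subseteq> {0<..<1}" using cl[of n] k(2)[of n] r by force
    qed
    show "\<psi> n z = 1" by (simp add: \<psi>_def)
    show "\<bar>\<psi> n x\<bar> \<le> 1" for x
    proof -
      have "0 \<le> max 0 (1 - (k n * (x - z))\<^sup>2)" "max 0 (1 - (k n * (x - z))\<^sup>2) \<le> 1" by auto
      then show ?thesis unfolding \<psi>_def by (simp add: power_le_one)
    qed
  next
    fix x assume x: "x \<noteq> z"
    have "eventually (\<lambda>n. n \<ge> nat \<lceil>2 / \<bar>x - z\<bar>\<rceil>) sequentially" by (rule eventually_ge_at_top)
    then have "eventually (\<lambda>n. \<psi> n x = 0) sequentially"
    proof eventually_elim
      case (elim n)
      then have "2 / \<bar>x - z\<bar> \<le> k n" using k(3)[of n] by linarith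
      then have "2 \<le> k n * \<bar>x - z\<bar>" using x by (subst (asm) pos_divide_le_eq) auto
      then have "1 / k n < \<bar>x - z\<bar>" using k(1)[of n] by (simp add: field_simps)
      then show ?case using small[of n x] by linarith
    qed
    then show "(\<lambda>n. \<psi> n x) \<longlonglongrightarrow> 0" by (rule tendsto_eventually)
  qed
qed

text \<open>If \<open>v\<close> were the weak derivative, then \<open>\<integral> (g + v) \<psi> = -\<psi>(z)\<close> for all test functions, and test
  functions that concentrate at \<open>z\<close> make the left side vanish and the right side \<open>-1\<close>.\<close>

lemma jump_function_not_weakly_differentiable:
  fixes g v :: "real \<Rightarrow> real"
  assumes z: "0 < z" "z < 1" and g: "integrable leb01 g"
    and gc: "\<And>x. x \<in> {0<..<1} - {z} \<Longrightarrow> isCont g x" and g0: "\<And>x. x \<in> {0<..<1} \<Longrightarrow> 0 \<le> g x"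
  shows "\<not> weak_deriv (jump_function c g z) v"
proof
  assume wd: "weak_deriv (jump_function c g z) v"
  then have v: "integrable leb01 v" by (simp add: weak_deriv_def)
  obtain \<psi> :: "nat \<Rightarrow> real \<Rightarrow> real" where \<psi>: "\<And>n. test_fun (\<psi> n)" and b: "\<And>n x. \<bar>\<psi> n x\<bar> \<le> 1"
    and one: "\<And>n. \<psi> n z = 1" and lim: "\<And>x. x \<noteq> z \<Longrightarrow> (\<lambda>n. \<psi> n x) \<longlonglongrightarrow> 0"
    using ex_test_funs_concentrating[OF z] by blast
  have m: "\<psi> n \<in> borel_measurable leb01" for n
  proof -
    obtain "continuous_on UNIV (\<psi> n)" using test_funD[OF \<psi>[of n]] by blast
    then show ?thesis using continuous_on_subset by (blast intro: continuous_leb01_measurable)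
  qed
  have "(LINT x|leb01. \<psi> n x * (g x + v x)) = -1" for n
  proof -
    have "integrable leb01 (\<lambda>x. \<psi> n x * g x)" "integrable leb01 (\<lambda>x. \<psi> n x * v x)"
      using integrable_bounded_mult[OF g m b] integrable_bounded_mult[OF v m b] by blast+
    moreover have "(LINT x|leb01. \<psi> n x * g x) + \<psi> n z = - (LINT x|leb01. v x * \<psi> n x)"
      using jump_function_weak_derivative[OF z g gc g0 \<psi>[of n], of c] wd \<psi>[of n]
      by (simp add: weak_deriv_def)
    ultimately show ?thesis using one[of n] by (simp add: distrib_left mult.commute)
  qed
  moreover have "(\<lambda>n. LINT x|leb01. \<psi> n x * (g x + v x)) \<longlonglongrightarrow> (LINT x|leb01. 0)"
  proof (rule integral_dominated_convergence[where w="\<lambda>x. \<bar>g x + v x\<bar>"])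
    show "(\<lambda>x. \<psi> n x * (g x + v x)) \<in> borel_measurable leb01" for n
      by (intro borel_measurable_times m borel_measurable_add borel_measurable_integrable g v)
    have "AE x in leb01. x \<noteq> z"
      by (subst AE_restrict_space_iff) (auto intro!: AE_I'[of "{z}"])
    then show "AE x in leb01. (\<lambda>n. \<psi> n x * (g x + v x)) \<longlonglongrightarrow> 0"
      by eventually_elim (use lim in \<open>auto intro: tendsto_mult_left_zero\<close>)
    show "AE x in leb01. norm (\<psi> n x * (g x + v x)) \<le> \<bar>g x + v x\<bar>" for n
      using b by (intro AE_I2) (simp add: abs_mult mult_left_le_one_le)
  qed (use g v in auto)
  ultimately show False by (simp add: LIMSEQ_const_iff)
qed

lemma positive_funI:
  assumes m: "u \<in> borel_measurable leb01" and A: "0 < A" "\<And>x. x \<in> {0<..<1} \<Longrightarrow> A \<le> u x"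
  shows "positive_fun u"
proof -
  have "esssup leb01 (\<lambda>x. - ereal (u x)) \<le> 0"
    using m A by (intro esssup_I AE_I2) (force intro: order_trans[OF less_imp_le])+
  moreover have "0 < esssup leb01 (\<lambda>x. ereal (u x))"
  proof (rule ccontr)
    assume "\<not> ?thesis"
    then have "AE x in leb01. u x \<le> 0"
      using esssup_AE[of "\<lambda>x. ereal (u x)" leb01]
      by (auto elim!: eventually_mono dest: order_trans simp: not_less zero_ereal_def)
    then have "AE x in leb01. False"
      using AE_space[of leb01] by eventually_elim (use A in force)
    then have "emeasure leb01 (space leb01) = 0"
      by (simp only: eventually_False ae_filter_eq_bot_iff)
    then show False by (simp add: emeasure_restrict_space)
  qed
  ultimately show ?thesis by (auto simp: positive_fun_def ereal_uminus_le_reorder)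
qed

section \<open>Construction of the singular solution\<close>

lemma Linf01_AE_bounded:
  assumes "a \<in> Linf01"
  obtains K where "a \<in> borel_measurable leb01" "0 \<le> K" "AE x in leb01. \<bar>a x\<bar> \<le> K"
proof -
  let ?M = "esssup leb01 (\<lambda>x. ereal \<bar>a x\<bar>)"
  have m: "a \<in> borel_measurable leb01" and M: "?M < \<infinity>" using assms by (auto simp: Linf01_def)
  have "AE x in leb01. ereal \<bar>a x\<bar> \<le> ?M" by (rule esssup_AE)
  then have "AE x in leb01. \<bar>a x\<bar> \<le> max 0 (real_of_ereal ?M)"
  proof eventually_elim
    case (elim x)
    then show ?case using M by (cases ?M) auto
  qed
  then show ?thesis using that[of "max 0 (real_of_ereal ?M)"] m by auto
qed

lemma leb01_integrable_subinterval:
  fixes h :: "real \<Rightarrow> real"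
  assumes "integrable leb01 h" "0 \<le> s" "t \<le> 1"
  shows "integrable (lebesgue_on {s<..<t}) h"
proof -
  have "set_integrable lebesgue {0<..<1} h"
    using assms(1) by (simp add: set_integrable_def integrable_restrict_space)
  then have "set_integrable lebesgue {s<..<t} h"
    by (rule set_integrable_subset) (use assms in auto)
  then show ?thesis by (simp add: set_integrable_def integrable_restrict_space)
qed

lemma integral_pos_interval:
  fixes h :: "real \<Rightarrow> real"
  assumes h: "integrable leb01 h" and st: "0 \<le> s" "s < t" "t \<le> 1"
    and pos: "AE x in lebesgue. x \<in> {s<..<t} \<longrightarrow> 0 < h x"
  shows "0 < integral {s..t} h"
proof -
  have int: "integrable (lebesgue_on {s<..<t}) h"
    by (rule leb01_integrable_subinterval[OF h]) (use st in auto)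
  interpret finite_measure "lebesgue_on {s<..<t}"
    using st by (intro finite_measureI) (simp add: emeasure_restrict_space)
  have "(LINT x|lebesgue_on {s<..<t}. 0) < (LINT x|lebesgue_on {s<..<t}. h x)"
  proof (rule integral_less_AE_space)
    show "AE x in lebesgue_on {s<..<t}. 0 < h x" using pos by (subst AE_restrict_space_iff) auto
    show "emeasure (lebesgue_on {s<..<t}) (space (lebesgue_on {s<..<t})) \<noteq> 0"
      using st by (simp add: space_restrict_space emeasure_restrict_space)
  qed (use int in auto)
  also have "(LINT x|lebesgue_on {s<..<t}. h x) = integral {s..t} h"
    using lebesgue_integral_eq_integral[OF int] by (simp add: integral_open_interval_real)
  finally show ?thesis by simp
qed

lemma interval_integral_eq_integral:
  fixes h :: "real \<Rightarrow> real"
  assumes h: "integrable leb01 h" and st: "0 \<le> s" "s \<le> t" "t \<le> 1"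
  shows "(LINT x=s..t|lebesgue. h x) = integral {s..t} h" "(LINT x=t..s|lebesgue. h x) = - integral {s..t} h"
proof -
  have "integrable (lebesgue_on {s<..<t}) h"
    by (rule leb01_integrable_subinterval[OF h]) (use st in auto)
  then have "set_integrable lebesgue {s<..<t} h"
    by (simp add: set_integrable_def integrable_restrict_space)
  then have "(LINT x:{s<..<t}|lebesgue. h x) = integral {s..t} h"
    using set_lebesgue_integral_eq_integral(2) by (metis integral_open_interval_real)
  then show "(LINT x=s..t|lebesgue. h x) = integral {s..t} h" "(LINT x=t..s|lebesgue. h x) = - integral {s..t} h"
    using st by (auto simp: interval_lebesgue_integral_def)
qed

text \<open>Solving \<open>w = g / sqrt(1 + g\<^sup>2)\<close> for the slope gives \<open>g = w / sqrt(1 - w\<^sup>2)\<close>, which blows up like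
  \<open>(1 - w)\<^sup>-\<^sup>1\<^sup>/\<^sup>2\<close> where the flux tends to \<open>1\<close>. This is where the two integrability conditions on \<open>a\<close>
  enter: \<open>1 - w\<close> will be a multiple of \<open>V(x) = \<integral>\<^sub>x\<^sup>z a\<close>.\<close>

lemma integrable_slope_if_rsqrt:
  fixes w V :: "real \<Rightarrow> real" and I :: real
  assumes S: "S \<in> sets lebesgue" and wm: "w \<in> borel_measurable (lebesgue_on S)"
    and w: "\<And>x. x \<in> S \<Longrightarrow> 0 \<le> w x \<and> w x < 1"
    and I: "0 < I" and V: "\<And>x. x \<in> S \<Longrightarrow> V x = I * (1 - w x)"
    and fin: "(\<integral>\<^sup>+x\<in>S. ennreal (V x powr (-(1/2))) \<partial>lebesgue) < \<infinity>"
  shows "integrable (lebesgue_on S) (\<lambda>x. w x / sqrt (1 - (w x)\<^sup>2))"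
proof (rule Bochner_Integration.integrable_bound)
  note [measurable] = wm
  let ?h = "\<lambda>x. (I * (1 - w x)) powr (-(1/2))"
  have sp: "space (lebesgue_on S) = S" by (simp add: space_restrict_space)
  have hm: "?h \<in> borel_measurable (lebesgue_on S)" by measurable
  have "integrable (lebesgue_on S) ?h"
  proof (rule integrableI_nonneg[OF hm])
    have "(\<integral>\<^sup>+x. ennreal (?h x) \<partial>lebesgue_on S) = (\<integral>\<^sup>+x. ennreal (V x powr (-(1/2))) \<partial>lebesgue_on S)"
      by (intro nn_integral_cong) (simp add: sp V)
    also have "\<dots> = (\<integral>\<^sup>+x\<in>S. ennreal (V x powr (-(1/2))) \<partial>lebesgue)"
      using S by (subst nn_integral_restrict_space) auto
    finally show "(\<integral>\<^sup>+x. ennreal (?h x) \<partial>lebesgue_on S) < \<infinity>" using fin by simp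
  qed auto
  then show "integrable (lebesgue_on S) (\<lambda>x. sqrt I * ?h x)" by simp
  show "(\<lambda>x. w x / sqrt (1 - (w x)\<^sup>2)) \<in> borel_measurable (lebesgue_on S)" by measurable
  show "AE x in lebesgue_on S. norm (w x / sqrt (1 - (w x)\<^sup>2)) \<le> norm (sqrt I * ?h x)"
  proof (rule AE_I2)
    fix x assume "x \<in> space (lebesgue_on S)"
    then have x: "0 \<le> w x" "w x < 1" using w sp by auto
    have "1 - w x \<le> 1 - (w x)\<^sup>2" using x by (simp add: power2_eq_square mult_left_le)
    then have "w x / sqrt (1 - (w x)\<^sup>2) \<le> 1 / sqrt (1 - w x)"
      using x by (intro frac_le) auto
    also have "\<dots> = sqrt I * ?h x"
      using x I by (simp add: powr_minus powr_half_sqrt real_sqrt_mult divide_simps)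
    finally show "norm (w x / sqrt (1 - (w x)\<^sup>2)) \<le> norm (sqrt I * ?h x)"
      using x by (simp add: abs_square_le_1 power_le_one)
  qed
qed

text \<open>The nonlinearity is constant on the range of \<open>u\<close> on either side of \<open>z\<close>, with constants chosen so
  that the flux climbs from \<open>0\<close> to \<open>1\<close> on \<open>[0,z]\<close> and returns to \<open>0\<close> on \<open>[z,1]\<close>.\<close>

proposition ex_singular_solution:
  fixes a :: "real \<Rightarrow> real" and z :: real
  assumes a: "a \<in> Linf01" and z: "0 < z" "z < 1"
    and apos: "AE x in lebesgue. x \<in> {0<..<z} \<longrightarrow> a x > 0"
    and aneg: "AE x in lebesgue. x \<in> {z<..<1} \<longrightarrow> a x < 0"
    and fin1: "(\<integral>\<^sup>+x\<in>{0<..<z}. ennreal ((LINT t=x..z|lebesgue. a t) powr (- (1/2))) \<partial>lebesgue) < \<infinity>"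
    and fin2: "(\<integral>\<^sup>+x\<in>{z<..<1}. ennreal ((LINT t=x..z|lebesgue. a t) powr (- (1/2))) \<partial>lebesgue) < \<infinity>"
    and pq: "p \<ge> 1" "q > 0" and lam: "lam > 0"
  shows "\<exists>f. cond_f1 p q f \<and> (\<exists>u. singular_solution a f lam u)"
proof -
  obtain K where am: "a \<in> borel_measurable leb01" and K0: "0 \<le> K" and K: "AE x in leb01. \<bar>a x\<bar> \<le> K"
    using Linf01_AE_bounded[OF a] by blast
  interpret L: finite_measure leb01 by (rule finite_measure_leb01)
  have ai: "integrable leb01 a" using am K by (intro L.integrable_const_bound[where B=K]) auto
  have nai: "integrable leb01 (\<lambda>x. - a x)" using ai by simp
  have aneg': "AE x in lebesgue. x \<in> {z<..<1} \<longrightarrow> 0 < - a x" using aneg by simp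
  have pos: "0 < integral {s..t} a" if "0 \<le> s" "s < t" "t \<le> z" for s t
    using that z by (intro integral_pos_interval ai eventually_mono[OF apos]) auto
  have neg: "integral {s..t} a < 0" if "z \<le> s" "s < t" "t \<le> 1" for s t
  proof -
    have "0 < integral {s..t} (\<lambda>x. - a x)"
      using that z by (intro integral_pos_interval nai eventually_mono[OF aneg']) auto
    then show ?thesis by simp
  qed
  define I1 where "I1 = integral {0..z} a"
  define I2 where "I2 = - integral {z..1} a"
  have I: "0 < I1" "0 < I2" using pos[of 0 z] neg[of z 1] z by (auto simp: I1_def I2_def)
  \<comment> \<open>The derivative of the flux: normalised so that the flux gains \<open>1\<close> on the left of \<open>z\<close> and loses \<open>1\<close> on the right.\<close>
  define \<beta> where "\<beta> x = a x * (if x \<le> z then 1 / I1 else 1 / I2)" for x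
  have \<beta>m: "\<beta> \<in> borel_measurable leb01"
  proof -
    have "\<beta> = (\<lambda>x. a x * (1 / I2 + (1 / I1 - 1 / I2) * (if x \<le> z then 1 else 0)))"
      by (auto simp: \<beta>_def)
    then show ?thesis by (simp only:) (intro borel_measurable_times borel_measurable_add borel_measurable_const am step_measurable)
  qed
  define KB where "KB = K * (1 / I1 + 1 / I2)"
  have \<beta>K: "AE x in leb01. \<bar>\<beta> x\<bar> \<le> KB"
    using K
  proof eventually_elim
    case (elim x)
    have "\<bar>if x \<le> z then 1 / I1 else 1 / I2\<bar> \<le> 1 / I1 + 1 / I2" using I by auto
    then show ?case unfolding \<beta>_def KB_def abs_mult using elim K0 by (intro mult_mono) auto
  qed
  have \<beta>i: "integrable leb01 \<beta>" using \<beta>m \<beta>K by (intro L.integrable_const_bound[where B=KB]) auto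
  have on: "h integrable_on {s..t}" if "integrable leb01 h" "0 \<le> s" "t \<le> 1" for h :: "real \<Rightarrow> real" and s t
    using leb01_integrable_imp_integrable_on[OF that(1)] that by (auto intro: integrable_on_subinterval)
  define w where "w x = integral {0..x} \<beta>" for x
  have wc: "continuous_on {0..1} w"
    unfolding w_def by (intro indefinite_integral_continuous_1 on \<beta>i) auto
  have w1: "1 - w x = integral {x..z} a / I1" if "0 \<le> x" "x \<le> z" for x
  proof -
    have "w x = integral {0..x} (\<lambda>t. a t * (1 / I1))"
      unfolding w_def using that by (intro integral_cong) (auto simp: \<beta>_def)
    also have "\<dots> = integral {0..x} a / I1" by (simp only: integral_mult_left) simp
    moreover have "integral {0..x} a + integral {x..z} a = I1"
      unfolding I1_def using that z by (intro Henstock_Kurzweil_Integration.integral_combine on ai) auto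
    ultimately show ?thesis using I by (simp add: field_simps)
  qed
  have wz: "w z = 1" using w1[of z] z by simp
  have w2: "1 - w x = - integral {z..x} a / I2" if "z \<le> x" "x \<le> 1" for x
  proof -
    have "w z + integral {z..x} \<beta> = w x"
      unfolding w_def using that z by (intro Henstock_Kurzweil_Integration.integral_combine on \<beta>i) auto
    moreover have "integral {z..x} \<beta> = integral {z..x} (\<lambda>t. a t * (1 / I2))"
      by (rule integral_spike[of "{z}"]) (auto simp: \<beta>_def)
    moreover have "\<dots> = integral {z..x} a / I2" by (simp only: integral_mult_left) simp
    ultimately show ?thesis using wz by simp
  qed
  have w_end: "w 1 = 0" using w2[of 1] z I by (simp add: I2_def)
  have w_range: "0 \<le> w x \<and> w x < 1" if x: "x \<in> {0..1} - {z}" for x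
  proof (cases "x < z")
    case True
    have "integral {0..x} a + integral {x..z} a = I1"
      unfolding I1_def using x True z by (intro Henstock_Kurzweil_Integration.integral_combine on ai) auto
    moreover have "0 \<le> integral {0..x} a" using pos[of 0 x] x True by (cases "x = 0") auto
    ultimately have "integral {x..z} a / I1 \<le> 1" using I by simp
    moreover have "0 < integral {x..z} a / I1" using pos[of x z] x True I by simp
    ultimately show ?thesis using w1[of x] x True by simp
  next
    case False
    then have xz: "z < x" "x \<le> 1" using x by auto
    have "integral {z..x} a + integral {x..1} a = integral {z..1} a"
      using xz z by (intro Henstock_Kurzweil_Integration.integral_combine on ai) auto
    moreover have "integral {x..1} a \<le> 0" using neg[of x 1] xz by (cases "x = 1") auto
    ultimately have "- integral {z..x} a / I2 \<le> 1" using I by (simp add: I2_def)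
    moreover have "0 < - integral {z..x} a / I2" using neg[of z x] xz I by (simp add: divide_neg_pos)
    ultimately show ?thesis using w2[of x] xz by simp
  qed
  define g where "g x = w x / sqrt (1 - (w x)\<^sup>2)" for x
  have sq: "(w x)\<^sup>2 < 1" if "x \<in> {0..1} - {z}" for x
    using w_range[OF that] by (simp add: abs_square_less_1)
  have g0: "0 \<le> g x" if "x \<in> {0<..<1}" for x
    using w_range[of x] sq[of x] wz that by (cases "x = z") (auto simp: g_def)
  \<comment> \<open>At \<open>z\<close> itself the slope is infinite; division by zero assigns it the harmless value \<open>0\<close>.\<close>
  have gz: "g z = 0" by (simp add: g_def wz)
  have gc: "isCont g x" if x: "x \<in> {0<..<1} - {z}" for x
  proof -
    have "isCont w x" using x continuous_on_interior[OF wc, of x] by auto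
    then show ?thesis unfolding g_def using sq[of x] x by (intro continuous_intros) auto
  qed
  have gw: "g x / sqrt (1 + (g x)\<^sup>2) = w x" if x: "x \<in> {0<..<1} - {z}" for x
  proof -
    have s: "(w x)\<^sup>2 < 1" using sq[of x] x by auto
    have "1 + (g x)\<^sup>2 = 1 / (1 - (w x)\<^sup>2)" using s by (simp add: g_def power_divide field_simps)
    then show ?thesis using s by (simp add: g_def real_sqrt_divide)
  qed
  have wm: "w \<in> borel_measurable (lebesgue_on S)" if "S \<subseteq> {0..1}" "S \<in> sets lebesgue" for S
    by (intro continuous_imp_measurable_on_sets_lebesgue continuous_on_subset[OF wc] that)
  have gi: "integrable leb01 g"
  proof -
    have "integrable (lebesgue_on {0<..<z}) g"
      unfolding g_def
    proof (rule integrable_slope_if_rsqrt[OF _ wm _ I(1) _ fin1])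
      show "(LINT t=x..z|lebesgue. a t) = I1 * (1 - w x)" if "x \<in> {0<..<z}" for x
        using interval_integral_eq_integral(1)[OF ai, of x z] w1[of x] that z I by simp
    qed (use z w_range in auto)
    moreover have "integrable (lebesgue_on {z<..<1}) g"
      unfolding g_def
    proof (rule integrable_slope_if_rsqrt[OF _ wm _ I(2) _ fin2])
      show "(LINT t=x..z|lebesgue. a t) = I2 * (1 - w x)" if "x \<in> {z<..<1}" for x
        using interval_integral_eq_integral(2)[OF ai, of z x] w2[of x] that z I by simp
    qed (use z w_range in auto)
    ultimately have "set_integrable lebesgue ({0<..<z} \<union> {z<..<1}) g"
      by (intro set_integrable_Un) (auto simp: set_integrable_def integrable_restrict_space)
    moreover have "(\<lambda>x. indicator ({0<..<z} \<union> {z<..<1}) x *\<^sub>R g x) = (\<lambda>x. indicator {0<..<1} x *\<^sub>R g x)"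
    proof
      show "indicator ({0<..<z} \<union> {z<..<1}) x *\<^sub>R g x = indicator {0<..<1} x *\<^sub>R g x" for x
        using z gz by (cases "x = z") (auto simp: indicator_def)
    qed
    ultimately show ?thesis by (simp add: set_integrable_def integrable_restrict_space)
  qed
  \<comment> \<open>\<open>u\<close> takes values in \<open>[A,B]\<close> to the right of \<open>z\<close> and in \<open>[B+1,c+1]\<close> to its left.\<close>
  define A where "A = max 1 (max (1 / (lam * I1)) (1 / (lam * I2)))"
  define c where "c = A + integral {0..1} g"
  define B where "B = c - integral {0..z} g"
  have gmono: "integral {0..s} g \<le> integral {0..t} g" if "0 \<le> s" "s \<le> t" "t \<le> 1" for s t
  proof -
    have "integral {0..s} g + integral {s..t} g = integral {0..t} g"
      using that by (intro Henstock_Kurzweil_Integration.integral_combine on gi) auto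
    moreover have "0 \<le> integral {s<..<t} g"
      using that g0 on[OF gi, of s t] by (intro Henstock_Kurzweil_Integration.integral_nonneg)
        (auto simp: integrable_on_open_interval_real)
    ultimately show ?thesis by (simp add: integral_open_interval_real)
  qed
  have AB: "A \<le> B" using gmono[of z 1] z by (simp add: B_def c_def)
  have BD: "B + 1 \<le> c + 1" using gmono[of 0 z] z by (simp add: B_def)
  have A_ge: "1 \<le> A" "1 / (lam * I1) \<le> A" "1 / (lam * I2) \<le> A" by (simp_all add: A_def)
  have c_pos: "0 < 1 / (lam * I1)" "0 < 1 / (lam * I2)" using lam I by simp_all
  obtain f where f: "cond_f1 p q f" and f2: "\<And>u. u \<in> {A..B} \<Longrightarrow> f u = 1 / (lam * I2)"
    and f1: "\<And>u. u \<in> {B+1..c+1} \<Longrightarrow> f u = 1 / (lam * I1)"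
    using ex_nonlinearity[OF pq c_pos A_ge AB BD] by blast
  let ?u = "jump_function c g z"
  have left: "?u x \<in> {B+1..c+1}" if "0 \<le> x" "x \<le> z" for x
    using gmono[of x z] gmono[of 0 x] that z by (simp add: jump_function_def B_def)
  have right: "?u x \<in> {A..B}" if "z < x" "x \<le> 1" for x
    using gmono[of z x] gmono[of x 1] that z by (simp add: jump_function_def B_def c_def)
  \<comment> \<open>Needed on the closed interval, because the flux is an integral over \<open>[0,x]\<close>.\<close>
  have source: "lam * a x * f (?u x) = \<beta> x" if "x \<in> {0..1}" for x
    using f1[OF left[of x]] f2[OF right[of x]] that lam by (auto simp: \<beta>_def)
  have w_eq: "integral {0..x} (\<lambda>x. lam * a x * f (?u x)) = w x" if "x \<le> 1" for x
    unfolding w_def using that by (intro integral_cong source) auto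
  have "bv_solution a f lam ?u"
  proof (rule jump_function_bv_solution[OF z gi gc g0])
    show "(\<lambda>x. lam * a x * f (?u x)) \<in> borel_measurable leb01"
      using \<beta>m by (subst measurable_cong[where g=\<beta>]) (simp_all only: space_leb01 source greaterThanLessThan_iff atLeastAtMost_iff less_imp_le)
    show "AE x in leb01. \<bar>lam * a x * f (?u x)\<bar> \<le> KB"
      using \<beta>K AE_space[of leb01] by eventually_elim (simp only: source space_leb01 greaterThanLessThan_iff atLeastAtMost_iff less_imp_le)
    have "(LINT x|leb01. lam * a x * f (?u x)) = (LINT x|leb01. \<beta> x)"
      by (intro Bochner_Integration.integral_cong source) auto
    also have "\<dots> = w 1"
      using lebesgue_integral_eq_integral[OF \<beta>i] by (simp add: w_def integral_open_interval_real)
    finally show "(LINT x|leb01. lam * a x * f (?u x)) = 0" by (simp add: w_end)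
    show "integral {0..z} (\<lambda>x. lam * a x * f (?u x)) = 1" using w_eq[of z] wz z by simp
    show "g x / sqrt (1 + (g x)\<^sup>2) = integral {0..x} (\<lambda>x. lam * a x * f (?u x))"
      if "x \<in> {0<..<1} - {z}" for x using gw[OF that] w_eq[of x] that by simp
    show "continuous_on {0..1} (\<lambda>x. integral {0..x} (\<lambda>x. lam * a x * f (?u x)))"
      using wc by (rule continuous_on_cong[THEN iffD2, OF refl, rotated]) (use w_eq in auto)
  qed
  moreover have "positive_fun ?u"
  proof (rule positive_funI[of _ A])
    show "?u \<in> borel_measurable leb01" by (rule jump_function_measurable[OF z gi gc g0])
    show "A \<le> ?u x" if "x \<in> {0<..<1}" for x
      using left[of x] right[of x] AB that by (cases "x \<le> z") auto
  qed (simp add: A_def)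
  moreover have "\<not> regular_solution a f lam ?u"
    using jump_function_not_weakly_differentiable[OF z gi gc g0, of c] unfolding regular_solution_def by blast
  ultimately show ?thesis using f unfolding singular_solution_def by blast
qed

theorem theorem7p3:
  fixes a :: "real \<Rightarrow> real" and z :: real
  assumes "a \<in> Linf01"
    and "(LINT x|leb01. a x) < 0"
    and "0 < z" and "z < 1"
    and "AE x in lebesgue. x \<in> {0<..<z} \<longrightarrow> a x > 0"
    and "AE x in lebesgue. x \<in> {z<..<1} \<longrightarrow> a x < 0"
    and "(\<integral>\<^sup>+x\<in>{0<..<z}. ennreal ((LINT t=x..z|lebesgue. a t) powr (- (1/2))) \<partial>lebesgue) < \<infinity>"
    and "(\<integral>\<^sup>+x\<in>{z<..<1}. ennreal ((LINT t=x..z|lebesgue. a t) powr (- (1/2))) \<partial>lebesgue) < \<infinity>"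
  shows "(\<forall>p>1. \<forall>q\<in>{0<..<1}. \<exists>f. cond_f1 p q f \<and>
            (\<exists>lam>0. \<exists>u. singular_solution a f lam u)) \<and>
         (\<forall>q\<in>{0<..<1}. \<forall>lambar>0. \<exists>\<epsilon>>0. \<exists>f. cond_f1 1 q f \<and>
            (\<exists>lam>0. \<exists>u. singular_solution a f lam u \<and> \<bar>lam - lambar\<bar> < \<epsilon>))"
proof (intro conjI allI ballI impI)
  note ex = ex_singular_solution[OF assms(1,3-8)]
  fix p q :: real assume "1 < p" "q \<in> {0<..<1}"
  then obtain f u where "cond_f1 p q f" "singular_solution a f 1 u" using ex[of p q 1] by auto
  then show "\<exists>f. cond_f1 p q f \<and> (\<exists>lam>0. \<exists>u. singular_solution a f lam u)"
    by (intro exI[of _ f] conjI exI[of _ 1] exI[of _ u]) auto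
next
  note ex = ex_singular_solution[OF assms(1,3-8)]
  fix q lambar :: real assume "q \<in> {0<..<1}" and lambar: "0 < lambar"
  then obtain f u where "cond_f1 1 q f" "singular_solution a f lambar u" using ex[of 1 q lambar] by auto
  then show "\<exists>\<epsilon>>0. \<exists>f. cond_f1 1 q f \<and>
      (\<exists>lam>0. \<exists>u. singular_solution a f lam u \<and> \<bar>lam - lambar\<bar> < \<epsilon>)"
    by (intro exI[of _ 1] conjI exI[of _ f] exI[of _ lambar] exI[of _ u]) (use lambar in auto)
qed

end
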